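(* Let $X$ be a Lévy process on $\mathbf{R}^d$ with characteristic exponent $\Psi$ and $L^2$-generator $\mathscr{L}$, and let $H$ denote the weak solution to the stochastic heat equation $\partial_tH=\mathscr{L}H+\dot w$, $H(0,\cdot)=0$. Then for all $\phi\in\mathscr{S}(\mathbf{R}^d)$, $\lambda>0$, and $t\ge0$, $$\frac{1-e^{-2t/\lambda}}2\,\mathscr{E}(\lambda;\phi)\le\mathrm{E}\big(|H(t,\phi)|^2\big)\le\frac{e^{2t/\lambda}}2\,\mathscr{E}(\lambda;\phi),$$ where $$\mathscr{E}(\lambda;\phi):=\frac1{(2\pi)^d}\int_{\mathbf{R}^d}\frac{|\hat\phi(\xi)|^2}{(1/\lambda)+\mathrm{Re}\,\Psi(\xi)}\,d\xi.$$
   Context: Lévy process: $X_0=0$, $\mathrm{E}\,e^{i\xi\cdot X_t}=e^{-t\Psi(\xi)}$. Fourier transform: $\hat f(\xi)=\int_{\mathbf{R}^d}e^{i\xi\cdot x}f(x)\,dx$. $(P^*_tf)(x):=\mathrm{E} f(x-X_t)$. $\mathscr{S}(\mathbf{R}^d)$ is the space of rapidly decreasing test functions. $\dot w$ is space-time white noise on $\mathbf{R}_+\times\mathbf{R}^d$. The weak solution is the Wiener integral $H(t,\phi):=\int_0^t\int_{\mathbf{R}^d}(P^*_{t-s}\phi)(y)\,w(dy\,ds)$ for $t\ge0$, $\phi\in\mathscr{S}(\mathbf{R}^d)$. *)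

theory Defs
  imports "HOL-Probability.Probability"
begin

definition levy_process :: "'p measure \<Rightarrow> (real \<Rightarrow> 'p \<Rightarrow> 'a::euclidean_space) \<Rightarrow> bool" where
  "levy_process M X \<longleftrightarrow>
     prob_space M \<and>
     (\<forall>t\<ge>0. X t \<in> borel_measurable M) \<and>
     (AE \<omega> in M. X 0 \<omega> = 0) \<and>
     (\<forall>n (t :: nat \<Rightarrow> real). 0 \<le> t 0 \<and> mono t \<longrightarrow>
        prob_space.indep_vars M (\<lambda>_. borel) (\<lambda>i \<omega>. X (t (Suc i)) \<omega> - X (t i) \<omega>) {..<n}) \<and>
     (\<forall>s\<ge>0. \<forall>h\<ge>0. distr M borel (\<lambda>\<omega>. X (s + h) \<omega> - X s \<omega>) = distr M borel (X h)) \<and>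
     (AE \<omega> in M. (\<forall>t\<ge>0. ((\<lambda>s. X s \<omega>) \<longlongrightarrow> X t \<omega>) (at_right t)) \<and>
                 (\<forall>t>0. \<exists>l. ((\<lambda>s. X s \<omega>) \<longlongrightarrow> l) (at_left t)))"

definition characteristic_exponent ::
    "'p measure \<Rightarrow> (real \<Rightarrow> 'p \<Rightarrow> 'a::euclidean_space) \<Rightarrow> ('a \<Rightarrow> complex) \<Rightarrow> bool" where
  "characteristic_exponent M X \<Psi> \<longleftrightarrow>
     (\<forall>t\<ge>0. \<forall>\<xi>. (LINT \<omega>|M. cis (\<xi> \<bullet> X t \<omega>)) = exp (- (of_real t * \<Psi> \<xi>)))"

definition transition_op ::
    "'p measure \<Rightarrow> (real \<Rightarrow> 'p \<Rightarrow> 'a::euclidean_space) \<Rightarrow> real \<Rightarrow> ('a \<Rightarrow> complex) \<Rightarrow> 'a \<Rightarrow> complex" where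
  "transition_op M X t f x = (LINT \<omega>|M. f (x + X t \<omega>))"

definition dual_transition_op ::
    "'p measure \<Rightarrow> (real \<Rightarrow> 'p \<Rightarrow> 'a::euclidean_space) \<Rightarrow> real \<Rightarrow> ('a \<Rightarrow> complex) \<Rightarrow> 'a \<Rightarrow> complex" where
  "dual_transition_op M X t f x = (LINT \<omega>|M. f (x - X t \<omega>))"

definition L2_functions :: "('a::euclidean_space \<Rightarrow> complex) set" where
  "L2_functions = {f \<in> borel_measurable lborel. integrable lborel (\<lambda>x. (cmod (f x))\<^sup>2)}"

text \<open>The unbounded operator is represented by its graph; L2 elements are represented by
  functions, so the graph is closed under almost-everywhere equality in both components.\<close>

definition L2_generator ::
    "'p measure \<Rightarrow> (real \<Rightarrow> 'p \<Rightarrow> 'a::euclidean_space) \<Rightarrow> (('a \<Rightarrow> complex) \<times> ('a \<Rightarrow> complex)) set" where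
  "L2_generator M X =
     {(f, g). f \<in> L2_functions \<and> g \<in> L2_functions \<and>
        ((\<lambda>t. \<integral>\<^sup>+x. ennreal ((cmod ((transition_op M X t f x - f x) / of_real t - g x))\<^sup>2) \<partial>lborel)
           \<longlongrightarrow> 0) (at_right 0)}"

definition fourier_transform :: "('a::euclidean_space \<Rightarrow> complex) \<Rightarrow> 'a \<Rightarrow> complex" where
  "fourier_transform f \<xi> = (LINT x|lborel. cis (\<xi> \<bullet> x) * f x)"

fun iterated_partial ::
    "'a::euclidean_space list \<Rightarrow> ('a \<Rightarrow> complex) \<Rightarrow> 'a \<Rightarrow> complex" where
  "iterated_partial [] f = f"
| "iterated_partial (b # bs) f = (\<lambda>x. frechet_derivative (iterated_partial bs f) (at x) b)"

definition schwartz_space :: "('a::euclidean_space \<Rightarrow> complex) set" where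
  "schwartz_space = {f. \<forall>bs. set bs \<subseteq> Basis \<longrightarrow>
      (\<forall>x. iterated_partial bs f differentiable (at x)) \<and>
      (\<forall>k::nat. \<exists>C. \<forall>x. (1 + norm x) ^ k * cmod (iterated_partial bs f x) \<le> C)}"

definition noise_sets :: "(real \<times> 'a::euclidean_space) set set" where
  "noise_sets = {A \<in> sets borel. A \<subseteq> {0..} \<times> UNIV \<and> emeasure lborel A < \<infinity>}"

text \<open>Degenerate (almost surely zero) variables count as Gaussian.\<close>

definition centered_gaussian :: "'q measure \<Rightarrow> ('q \<Rightarrow> real) \<Rightarrow> bool" where
  "centered_gaussian N Y \<longleftrightarrow> Y \<in> borel_measurable N \<and>
     ((AE \<omega> in N. Y \<omega> = 0) \<or> (\<exists>\<sigma>>0. distributed N lborel Y (normal_density 0 \<sigma>)))"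

text \<open>Space-time white noise: a centered Gaussian family indexed by the Borel sets of finite
  Lebesgue measure in the half-space, whose covariance is the measure of the intersection.
  Only values of \<open>w\<close> on \<open>noise_sets\<close> matter.\<close>

definition white_noise ::
    "'q measure \<Rightarrow> ((real \<times> 'a::euclidean_space) set \<Rightarrow> 'q \<Rightarrow> real) \<Rightarrow> bool" where
  "white_noise N w \<longleftrightarrow>
     prob_space N \<and>
     (\<forall>\<A> c. finite \<A> \<and> \<A> \<subseteq> noise_sets \<longrightarrow> centered_gaussian N (\<lambda>\<omega>. \<Sum>A\<in>\<A>. c A * w A \<omega>)) \<and>
     (\<forall>A\<in>noise_sets. \<forall>B\<in>noise_sets. (LINT \<omega>|N. w A \<omega> * w B \<omega>) = measure lborel (A \<inter> B))"

text \<open>\<open>Y\<close> is a version of the Wiener integral of the complex-valued \<open>f\<close>: the L2 limit of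
  integrals of simple functions that converge to \<open>f\<close> in L2. This determines \<open>Y\<close> up to null
  sets, and \<open>f\<close> and \<open>Y\<close> are necessarily square integrable.\<close>

definition has_wiener_integral ::
    "'q measure \<Rightarrow> ((real \<times> 'a::euclidean_space) set \<Rightarrow> 'q \<Rightarrow> real) \<Rightarrow>
     (real \<times> 'a \<Rightarrow> complex) \<Rightarrow> ('q \<Rightarrow> complex) \<Rightarrow> bool" where
  "has_wiener_integral N w f Y \<longleftrightarrow>
     f \<in> borel_measurable borel \<and> Y \<in> borel_measurable N \<and>
     (\<exists>\<A> c. (\<forall>n::nat. finite (\<A> n) \<and> \<A> n \<subseteq> noise_sets) \<and>
        (\<lambda>n. \<integral>\<^sup>+z\<in>{0..} \<times> UNIV.
           ennreal ((cmod (f z - (\<Sum>A\<in>\<A> n. c n A * indicator A z)))\<^sup>2) \<partial>lborel)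
          \<longlonglongrightarrow> 0 \<and>
        (\<lambda>n. \<integral>\<^sup>+\<omega>. ennreal ((cmod (Y \<omega> - (\<Sum>A\<in>\<A> n. c n A * of_real (w A \<omega>))))\<^sup>2) \<partial>N)
          \<longlonglongrightarrow> 0)"

text \<open>The weak solution of the heat equation for the generator of \<open>X\<close>, driven by \<open>w\<close> and
  started at zero; each \<open>H t \<phi>\<close> is fixed up to null sets.\<close>

definition weak_heat_solution ::
    "'p measure \<Rightarrow> (real \<Rightarrow> 'p \<Rightarrow> 'a::euclidean_space) \<Rightarrow>
     'q measure \<Rightarrow> ((real \<times> 'a) set \<Rightarrow> 'q \<Rightarrow> real) \<Rightarrow>
     (real \<Rightarrow> ('a \<Rightarrow> complex) \<Rightarrow> 'q \<Rightarrow> complex) \<Rightarrow> bool" where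
  "weak_heat_solution M X N w H \<longleftrightarrow>
     (\<forall>t\<ge>0. \<forall>\<phi>\<in>schwartz_space.
        has_wiener_integral N w
          (\<lambda>(s, y). indicator {0..t} s * dual_transition_op M X (t - s) \<phi> y) (H t \<phi>))"

definition levy_energy :: "('a::euclidean_space \<Rightarrow> complex) \<Rightarrow> real \<Rightarrow> ('a \<Rightarrow> complex) \<Rightarrow> real" where
  "levy_energy \<Psi> \<kappa> \<phi> =
     1 / (2 * pi) ^ DIM('a) *
     (LINT \<xi>|lborel. (cmod (fourier_transform \<phi> \<xi>))\<^sup>2 / (1 / \<kappa> + Re (\<Psi> \<xi>)))"

end

theory Submission imports Defs begin

text \<open>The Wiener isometry turns the second moment of \<open>H t \<phi>\<close> into the integral of
  \<open>\<bar>P*\<^sub>s \<phi>\<bar>\<^sup>2\<close> over \<open>[0, t] \<times> R\<^sup>d\<close>. The Fourier transform of \<open>P*\<^sub>s \<phi>\<close> is that of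
  \<open>\<phi>\<close> times \<open>exp (- s \<Psi>)\<close>, so by Plancherel and Tonelli the second moment is
  \<open>(2\<pi>)\<close> to the power \<open>-d\<close> times the integral over \<open>\<xi>\<close> of \<open>\<bar>FT \<phi> \<xi>\<bar>\<^sup>2\<close> times the integral
  of \<open>exp (- 2 s Re \<Psi>)\<close> for \<open>s \<in> [0, t]\<close>. For \<open>0 \<le> s \<le> t\<close> the latter integrand lies between
  \<open>exp (- 2 s q)\<close> and \<open>exp (2 t / \<kappa>) exp (- 2 s q)\<close>, where \<open>q = 1 / \<kappa> + Re \<Psi>\<close>, and these
  integrate to the two bounds.\<close>

section \<open>Fourier transform of the Gaussian\<close>

lemma borel_measurable_cis [measurable]: "cis \<in> borel_measurable borel"
  by (intro borel_measurable_continuous_onI continuous_intros)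

lemma borel_measurable_cnj [measurable]: "cnj \<in> borel_measurable borel"
  by (intro borel_measurable_continuous_onI continuous_intros)

lemma integral_lborel_affine:
  fixes f :: "'a::euclidean_space \<Rightarrow> 'b::{banach, second_countable_topology}"
  assumes [measurable]: "f \<in> borel_measurable borel" and c: "c \<noteq> 0"
  shows "(LINT x|lborel. f x) = \<bar>c\<bar> ^ DIM('a) *\<^sub>R (LINT x|lborel. f (t + c *\<^sub>R x))"
  by (subst lborel_affine[OF c, of t]) (simp add: integral_density integral_distr)

lemma integrable_lborel_affine:
  fixes f :: "'a::euclidean_space \<Rightarrow> 'b::{banach, second_countable_topology}"
  assumes "integrable lborel f" and c: "c \<noteq> 0"
  shows "integrable lborel (\<lambda>x. f (t + c *\<^sub>R x))"
proof -
  have [measurable]: "f \<in> borel_measurable borel" using assms by auto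
  have "integrable (density (distr lborel borel (\<lambda>x. t + c *\<^sub>R x)) (\<lambda>_. ennreal (\<bar>c\<bar> ^ DIM('a)))) f"
    using assms(1) by (subst (asm) lborel_affine[OF c, of t]) (simp add: ennreal_power)
  then have "integrable lborel (\<lambda>x. \<bar>c\<bar> ^ DIM('a) *\<^sub>R f (t + c *\<^sub>R x))"
    by (subst (asm) integrable_density) (auto simp: integrable_distr_eq)
  from integrable_scaleR_right[OF this, of "1 / \<bar>c\<bar> ^ DIM('a)"] c show ?thesis
    by simp
qed

text \<open>\<open>lborel\<close> is the image, under the coordinate map, of a finite product of
  one-dimensional Lebesgue measures, where integrals of product functions factor.\<close>

lemma prod_Basis_lborel:
  fixes f :: "'a::euclidean_space \<Rightarrow> real \<Rightarrow> 'b::{real_normed_field, banach, second_countable_topology}"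
  assumes f: "\<And>b. b \<in> Basis \<Longrightarrow> integrable lborel (f b)"
  shows integrable_lborel_prod: "integrable lborel (\<lambda>x. \<Prod>b\<in>Basis. f b (x \<bullet> b))"
    and integral_lborel_prod: "(LINT x|lborel. (\<Prod>b\<in>Basis. f b (x \<bullet> b))) = (\<Prod>b\<in>Basis. (LINT y|lborel. f b y))"
proof -
  interpret product_sigma_finite "\<lambda>_::'a. lborel :: real measure" ..
  have [measurable]: "f b \<in> borel_measurable borel" if "b \<in> Basis" for b using f[OF that] by auto
  have m: "(\<lambda>x. \<Prod>b\<in>Basis. f b (x \<bullet> b)) \<in> borel_measurable borel"
    by measurable
  have eq: "(\<Prod>b\<in>Basis. f b ((\<Sum>c\<in>Basis. z c *\<^sub>R c) \<bullet> b)) = (\<Prod>b\<in>Basis. f b (z b))" for z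
    by (intro prod.cong) (auto simp: inner_sum_left_Basis)
  show "integrable lborel (\<lambda>x. \<Prod>b\<in>Basis. f b (x \<bullet> b))"
    by (subst lborel_eq, subst integrable_distr_eq) (use m in \<open>auto simp: eq intro!: product_integrable_prod f\<close>)
  show "(LINT x|lborel. (\<Prod>b\<in>Basis. f b (x \<bullet> b))) = (\<Prod>b\<in>Basis. (LINT y|lborel. f b y))"
    by (subst lborel_eq, subst integral_distr) (use m in \<open>auto simp: eq intro!: product_integral_prod f\<close>)
qed

text \<open>Left unnormalised, so that its Fourier transform is a multiple of itself; the factor
  \<open>sqrt (2 * pi) ^ DIM('a)\<close> is also its total mass.\<close>

definition gauss :: "'a::euclidean_space \<Rightarrow> real" where
  "gauss x = exp (- (norm x)\<^sup>2 / 2)"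

lemma gauss_pos: "0 < gauss x"
  by (simp add: gauss_def)

lemma borel_measurable_gauss [measurable]: "gauss \<in> borel_measurable borel"
  unfolding gauss_def by measurable

text \<open>Once \<open>sqrt (2 * pi)\<close> is factored out, the integral is the characteristic
  function of the standard normal distribution.\<close>

lemma gauss_real_fourier:
  fixes u :: real
  shows "integrable lborel (\<lambda>x. cis (x * u) * exp (- x\<^sup>2 / 2))"
    and "(LINT x|lborel. cis (x * u) * exp (- x\<^sup>2 / 2)) = sqrt (2 * pi) * exp (- u\<^sup>2 / 2)"
proof -
  have i: "integrable lborel (\<lambda>x. std_normal_density x *\<^sub>R cis (x * u))"
    by (rule Bochner_Integration.integrable_bound[OF integrable_normal_density[of 1 0]]) (auto intro!: AE_I2)
  have e: "cis (x * u) * exp (- x\<^sup>2 / 2) = sqrt (2 * pi) *\<^sub>R (std_normal_density x *\<^sub>R cis (x * u))" for x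
    by (simp add: std_normal_density_def scaleR_conv_of_real)
  show "integrable lborel (\<lambda>x. cis (x * u) * exp (- x\<^sup>2 / 2))"
    unfolding e by (intro integrable_scaleR_right i)
  have "(LINT x|lborel. std_normal_density x *\<^sub>R cis (x * u)) = char std_normal_distribution u"
    unfolding char_def by (subst integral_density) (auto simp: mult.commute cis_conv_exp)
  then show "(LINT x|lborel. cis (x * u) * exp (- x\<^sup>2 / 2)) = sqrt (2 * pi) * exp (- u\<^sup>2 / 2)"
    unfolding e by (simp add: char_std_normal_distribution scaleR_conv_of_real del: scaleR_scaleR)
qed

lemma cis_sum: "finite A \<Longrightarrow> cis (sum f A) = (\<Prod>a\<in>A. cis (f a))"
  by (induction A rule: finite_induct) (auto simp: cis_mult[symmetric])

text \<open>Both the Gaussian and the phase factor over the coordinates, which reduces the claim to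
  dimension one.\<close>

lemma gauss_fourier:
  fixes u :: "'a::euclidean_space"
  shows integrable_cis_gauss: "integrable lborel (\<lambda>x. cis (x \<bullet> u) * gauss x)"
    and integral_cis_gauss: "(LINT x|lborel. cis (x \<bullet> u) * gauss x) = sqrt (2 * pi) ^ DIM('a) * gauss u"
proof -
  have g: "gauss x = (\<Prod>b\<in>Basis. exp (- (x \<bullet> b)\<^sup>2 / 2))" for x :: 'a
  proof -
    have "(norm x)\<^sup>2 = (\<Sum>b\<in>Basis. (x \<bullet> b)\<^sup>2)"
      unfolding power2_norm_eq_inner by (subst euclidean_inner) (simp add: power2_eq_square)
    then have "- (norm x)\<^sup>2 / 2 = (\<Sum>b\<in>Basis. - (x \<bullet> b)\<^sup>2 / 2)"
      by (simp add: sum_negf sum_divide_distrib)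
    then show ?thesis
      unfolding gauss_def by (simp only: exp_sum finite_Basis)
  qed
  have e: "cis (x \<bullet> u) * gauss x = (\<Prod>b\<in>Basis. cis ((x \<bullet> b) * (u \<bullet> b)) * exp (- (x \<bullet> b)\<^sup>2 / 2))" for x
    by (simp add: g prod.distrib euclidean_inner[of x u] cis_sum)
  show "integrable lborel (\<lambda>x. cis (x \<bullet> u) * gauss x)"
    unfolding e by (intro integrable_lborel_prod gauss_real_fourier)
  show "(LINT x|lborel. cis (x \<bullet> u) * gauss x) = sqrt (2 * pi) ^ DIM('a) * gauss u"
    unfolding e by (subst integral_lborel_prod)
      (simp_all only: g gauss_real_fourier prod.distrib prod_constant of_real_mult of_real_prod of_real_power)
qed

lemma integrable_gauss: "integrable lborel (gauss :: 'a::euclidean_space \<Rightarrow> real)"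
  using integrable_norm[OF integrable_cis_gauss[of "0::'a"]] by (simp add: gauss_pos less_imp_le)

lemma integral_gauss: "(LINT x|lborel. gauss (x::'a::euclidean_space)) = sqrt (2 * pi) ^ DIM('a)"
proof -
  have "complex_of_real (LINT x|lborel. gauss (x::'a)) = complex_of_real (sqrt (2 * pi) ^ DIM('a))"
    using integral_cis_gauss[of "0::'a"] by (simp add: gauss_def)
  then show ?thesis using of_real_eq_iff by blast
qed

section \<open>Plancherel's theorem for bounded continuous integrable functions\<close>

lemma (in pair_sigma_finite) integrable_pair_dominated:
  fixes F :: "'a \<Rightarrow> 'b \<Rightarrow> 'c::{banach, second_countable_topology}"
  assumes [measurable]: "(\<lambda>(x, y). F x y) \<in> borel_measurable (M1 \<Otimes>\<^sub>M M2)"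
    and a: "integrable M1 a" and b: "integrable M2 b"
    and le: "\<And>x y. norm (F x y) \<le> a x * b y"
  shows "integrable (M1 \<Otimes>\<^sub>M M2) (\<lambda>(x, y). F x y)"
proof (rule Bochner_Integration.integrable_bound)
  have [measurable]: "a \<in> borel_measurable M1" "b \<in> borel_measurable M2" using a b by auto
  show "integrable (M1 \<Otimes>\<^sub>M M2) (\<lambda>(x, y). a x * b y :: real)"
    by (intro Fubini_integrable) (use a b in \<open>auto simp: abs_mult\<close>)
qed (use le in \<open>auto intro!: AE_I2 intro: order_trans[OF _ abs_ge_self]\<close>)

text \<open>In the uses below the phase has modulus one and the remaining factors depend on one
  variable each, so a product bound is the natural condition for Fubini.\<close>

lemma (in pair_sigma_finite) integral_swap_dominated:
  fixes F :: "'a \<Rightarrow> 'b \<Rightarrow> 'c::{banach, second_countable_topology}"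
  assumes "(\<lambda>(x, y). F x y) \<in> borel_measurable (M1 \<Otimes>\<^sub>M M2)"
    and "integrable M1 a" and "integrable M2 b"
    and "\<And>x y. norm (F x y) \<le> a x * b y"
  shows "(LINT x|M1. LINT y|M2. F x y) = (LINT y|M2. LINT x|M1. F x y)"
  using Fubini_integral[OF integrable_pair_dominated[OF assms]] by simp

lemma borel_measurable_fourier_transform [measurable (raw)]:
  assumes [measurable]: "f \<in> borel_measurable lborel"
  shows "fourier_transform f \<in> borel_measurable borel"
  unfolding fourier_transform_def[abs_def] by measurable

lemma integrable_cis_mult:
  assumes "integrable M f" and [measurable]: "u \<in> borel_measurable M"
  shows "integrable M (\<lambda>x. cis (u x) * f x)"
proof (rule Bochner_Integration.integrable_bound[OF assms(1)])
  have [measurable]: "f \<in> borel_measurable M" using assms by auto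
  show "(\<lambda>x. cis (u x) * f x) \<in> borel_measurable M" by measurable
qed (auto simp: norm_mult)

lemma norm_fourier_transform_le: "cmod (fourier_transform f \<xi>) \<le> (LINT x|lborel. cmod (f x))"
  unfolding fourier_transform_def
  by (rule order_trans[OF integral_norm_bound]) (simp add: norm_mult)

text \<open>Dilation turns a Gaussian of width \<open>m\<close> into one of width
  \<open>1 / m\<close> whose total mass in \<open>u\<close> is \<open>(2 * pi) ^ DIM('a)\<close> for
  every \<open>m\<close>: an approximate identity up to that constant.\<close>

lemma integral_cis_gauss_scaled:
  fixes u :: "'a::euclidean_space"
  assumes m: "m > 0"
  shows "(LINT x|lborel. cis (x \<bullet> u) * gauss (x /\<^sub>R m)) = m ^ DIM('a) * (sqrt (2 * pi) ^ DIM('a) * gauss (m *\<^sub>R u))"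
proof -
  have "(LINT x|lborel. cis (x \<bullet> u) * gauss (x /\<^sub>R m)) =
      \<bar>m\<bar> ^ DIM('a) *\<^sub>R (LINT x|lborel. cis ((0 + m *\<^sub>R x) \<bullet> u) * gauss ((0 + m *\<^sub>R x) /\<^sub>R m))"
    using m by (intro integral_lborel_affine) auto
  also have "\<dots> = m ^ DIM('a) *\<^sub>R (LINT x|lborel. cis (x \<bullet> (m *\<^sub>R u)) * gauss x)"
    using m by simp
  also have "\<dots> = m ^ DIM('a) * (sqrt (2 * pi) ^ DIM('a) * gauss (m *\<^sub>R u))"
    by (subst integral_cis_gauss) (simp add: scaleR_conv_of_real)
  finally show ?thesis .
qed

lemma integrable_gauss_scaled:
  assumes "m > 0"
  shows "integrable lborel (\<lambda>x::'a::euclidean_space. gauss (x /\<^sub>R m))"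
  using integrable_lborel_affine[OF integrable_gauss, of "1 / m" "0::'a"] assms by (simp add: field_simps)

text \<open>Fourier inversion with a Gaussian cut-off. After the transform is expanded and the
  integrals are exchanged, the frequency integral is a Gaussian in \<open>x - y\<close>, so the
  result averages \<open>g\<close> near \<open>x\<close> at scale \<open>1 / m\<close>.\<close>

lemma gaussian_mollification:
  fixes g :: "'a::euclidean_space \<Rightarrow> complex"
  assumes int: "integrable lborel g" and m: "m > 0"
  shows "(LINT \<xi>|lborel. cis (\<xi> \<bullet> x) * cnj (fourier_transform g \<xi>) * gauss (\<xi> /\<^sub>R m)) =
     sqrt (2 * pi) ^ DIM('a) * (LINT z|lborel. cnj (g (x - z /\<^sub>R m)) * gauss z)"
proof -
  have [measurable]: "g \<in> borel_measurable borel" using int by auto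
  have "(LINT \<xi>|lborel. cis (\<xi> \<bullet> x) * cnj (fourier_transform g \<xi>) * gauss (\<xi> /\<^sub>R m)) =
      (LINT \<xi>|lborel. LINT y|lborel. cis (\<xi> \<bullet> (x - y)) * cnj (g y) * gauss (\<xi> /\<^sub>R m))"
  proof (intro Bochner_Integration.integral_cong refl)
    fix \<xi> :: 'a
    have "cis (\<xi> \<bullet> x) * cnj (fourier_transform g \<xi>) * gauss (\<xi> /\<^sub>R m) =
       (LINT y|lborel. cis (\<xi> \<bullet> x) * cnj (cis (\<xi> \<bullet> y) * g y) * gauss (\<xi> /\<^sub>R m))"
      unfolding fourier_transform_def by (simp del: complex_cnj_mult Bochner_Integration.integral_cnj flip: Bochner_Integration.integral_cnj)
    also have "\<dots> = (LINT y|lborel. cis (\<xi> \<bullet> (x - y)) * cnj (g y) * gauss (\<xi> /\<^sub>R m))"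
      by (intro Bochner_Integration.integral_cong refl)
        (simp add: inner_diff_right cis_divide[symmetric] cis_cnj divide_inverse cis_inverse)
    finally show "cis (\<xi> \<bullet> x) * cnj (fourier_transform g \<xi>) * gauss (\<xi> /\<^sub>R m) =
       (LINT y|lborel. cis (\<xi> \<bullet> (x - y)) * cnj (g y) * gauss (\<xi> /\<^sub>R m))" .
  qed
  \<comment> \<open>The cut-off is integrable in \<open>\<xi>\<close> and \<open>g\<close> in
    \<open>y\<close>; without the cut-off the double integral need not converge absolutely.\<close>
  also have "\<dots> = (LINT y|lborel. LINT \<xi>|lborel. cis (\<xi> \<bullet> (x - y)) * cnj (g y) * gauss (\<xi> /\<^sub>R m))"
    by (rule lborel_pair.integral_swap_dominated[OF _ integrable_gauss_scaled[OF m] integrable_norm[OF int]])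
      (auto simp: norm_mult gauss_pos less_imp_le)
  also have "\<dots> = (LINT y|lborel. cnj (g y) * (LINT \<xi>|lborel. cis (\<xi> \<bullet> (x - y)) * gauss (\<xi> /\<^sub>R m)))"
    by (simp add: mult_ac flip: integral_mult_right_zero)
  also have "\<dots> = (LINT y|lborel. cnj (g y) * (m ^ DIM('a) * (sqrt (2 * pi) ^ DIM('a) * gauss (m *\<^sub>R (x - y)))))"
    by (simp only: integral_cis_gauss_scaled[OF m])
  \<comment> \<open>Substitution \<open>y = x - z / m\<close>: the dilation factor is
    \<open>- (1 / m)\<close>, and its Jacobian cancels \<open>m ^ DIM('a)\<close>.\<close>
  also have "\<dots> = \<bar>- (1 / m)\<bar> ^ DIM('a) *\<^sub>R (LINT z|lborel. cnj (g (x + (- (1 / m)) *\<^sub>R z)) *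
      (m ^ DIM('a) * (sqrt (2 * pi) ^ DIM('a) * gauss (m *\<^sub>R (x - (x + (- (1 / m)) *\<^sub>R z))))))"
    using m by (intro integral_lborel_affine) auto
  also have "\<dots> = \<bar>- (1 / m)\<bar> ^ DIM('a) *\<^sub>R (LINT z|lborel. (m ^ DIM('a) * sqrt (2 * pi) ^ DIM('a)) * 
      (cnj (g (x - z /\<^sub>R m)) * gauss z))"
    using m by (simp add: mult_ac divide_inverse)
  also have "\<dots> = sqrt (2 * pi) ^ DIM('a) * (LINT z|lborel. cnj (g (x - z /\<^sub>R m)) * gauss z)"
    using m by (subst integral_mult_right_zero) (simp add: scaleR_conv_of_real power_divide)
  finally show ?thesis .
qed

text \<open>The factor \<open>gauss (\<xi> /\<^sub>R n)\<close> makes Fubini applicable to the square of the transform; it acts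
  on \<open>g\<close> as convolution with an approximate identity and increases to 1 as \<open>n\<close> grows.\<close>

lemma plancherel:
  fixes g :: "'a::euclidean_space \<Rightarrow> complex"
  assumes cont: "continuous_on UNIV g" and bnd: "\<And>x. cmod (g x) \<le> C" and int: "integrable lborel g"
  shows integrable_fourier_transform_square: "integrable lborel (\<lambda>\<xi>. (cmod (fourier_transform g \<xi>))\<^sup>2)"
    and integral_fourier_transform_square:
      "(LINT \<xi>|lborel. (cmod (fourier_transform g \<xi>))\<^sup>2) = (2 * pi) ^ DIM('a) * (LINT x|lborel. (cmod (g x))\<^sup>2)"
proof -
  have [measurable]: "g \<in> borel_measurable borel" using int by auto
  let ?G = "fourier_transform g"
  have [measurable]: "?G \<in> borel_measurable borel" by measurable
  define B where "B = (LINT x|lborel. cmod (g x))"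
  have B: "cmod (?G \<xi>) \<le> B" for \<xi> unfolding B_def by (rule norm_fourier_transform_le)
  \<comment> \<open>\<open>Suc\<close> keeps the width positive and makes
    \<open>inverse (m n)\<close> a standard null sequence.\<close>
  define m where "m n = real (Suc n)" for n
  have m: "m n > 0" for n by (simp add: m_def)
  define K where "K n x = (LINT z|lborel. cnj (g (x - z /\<^sub>R m n)) * gauss z)" for n x
  let ?c = "sqrt (2 * pi) ^ DIM('a)"
  have c: "?c * ?c = (2 * pi) ^ DIM('a)" by (simp only: power_mult_distrib[symmetric] real_sqrt_mult_self) simp
  have C: "C \<ge> 0" using bnd[of 0] norm_ge_zero order_trans by blast
  have Kbnd: "cmod (K n x) \<le> C * ?c" for n x
  proof -
    have "cmod (K n x) \<le> (LINT z|lborel. C * gauss (z::'a))"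
      unfolding K_def
    proof (rule Bochner_Integration.integral_norm_bound_integral)
      show "integrable lborel (\<lambda>z. C * gauss z)"
        using integrable_gauss by (rule integrable_mult_right)
      then show "integrable lborel (\<lambda>z. cnj (g (x - z /\<^sub>R m n)) * gauss z)"
        by (rule Bochner_Integration.integrable_bound, measurable)
          (use bnd C in \<open>auto simp: norm_mult abs_mult gauss_pos less_imp_le intro!: mult_right_mono AE_I2\<close>)
    qed (use bnd in \<open>auto simp: norm_mult gauss_pos less_imp_le intro!: mult_right_mono\<close>)
    then show ?thesis by (simp add: integral_gauss)
  qed
  \<comment> \<open>Continuity of \<open>g\<close> gives the pointwise limit under the integral,
    boundedness the dominating function \<open>C * gauss z\<close>.\<close>
  have Klim: "(\<lambda>n. K n x) \<longlonglongrightarrow> cnj (g x) * ?c" for x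
  proof -
    have "(\<lambda>n. K n x) \<longlonglongrightarrow> (LINT z|lborel. cnj (g x) * gauss (z::'a))"
      unfolding K_def
    proof (rule integral_dominated_convergence[where w="\<lambda>z. C * gauss z"])
      have "(\<lambda>n. x - z /\<^sub>R m n) \<longlonglongrightarrow> x - 0 *\<^sub>R z" for z
        unfolding m_def by (intro tendsto_intros LIMSEQ_inverse_real_of_nat)
      then have "(\<lambda>n. g (x - z /\<^sub>R m n)) \<longlonglongrightarrow> g x" for z
        using cont continuous_on_tendsto_compose[OF cont] by auto
      then show "AE z in lborel. (\<lambda>n. cnj (g (x - z /\<^sub>R m n)) * gauss z) \<longlonglongrightarrow> cnj (g x) * gauss z"
        by (intro AE_I2 tendsto_intros)
    qed (use integrable_gauss[where 'a='a] bnd C in \<open>auto simp: norm_mult gauss_pos less_imp_le intro!: mult_right_mono AE_I2\<close>)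
    then show ?thesis by (simp add: integral_gauss flip: of_real_power)
  qed
  have Kmeas[measurable]: "K n \<in> borel_measurable borel" for n
    unfolding K_def by measurable
  \<comment> \<open>The limit of \<open>I n\<close> is computed twice: on the side of
    \<open>g\<close> by dominated convergence, on the frequency side by monotone
    convergence.\<close>
  define I where "I n = (LINT \<xi>|lborel. (cmod (?G \<xi>))\<^sup>2 * gauss (\<xi> /\<^sub>R m n))" for n
  have intE: "integrable lborel (\<lambda>\<xi>. (cmod (?G \<xi>))\<^sup>2 * gauss (\<xi> /\<^sub>R m n))" for n
    by (rule Bochner_Integration.integrable_bound[OF integrable_mult_right[OF integrable_gauss_scaled[OF m[of n]], of "B\<^sup>2"]])
       (auto simp: abs_mult gauss_pos less_imp_le intro!: AE_I2 mult_right_mono power_mono B)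
  have Ieq: "complex_of_real (I n) = (LINT x|lborel. g x * (?c * K n x))" for n
  proof -
    have "complex_of_real (I n) = (LINT \<xi>|lborel. complex_of_real ((cmod (?G \<xi>))\<^sup>2 * gauss (\<xi> /\<^sub>R m n)))"
      unfolding I_def by (rule integral_complex_of_real[symmetric])
    \<comment> \<open>The square is split as a transform times its conjugate and only the first
      factor is expanded; the conjugate then appears exactly as in
      \<open>gaussian_mollification\<close>.\<close>
    also have "\<dots> = (LINT \<xi>|lborel. ?G \<xi> * (cnj (?G \<xi>) * gauss (\<xi> /\<^sub>R m n)))"
      by (intro Bochner_Integration.integral_cong refl) (simp add: complex_norm_square mult_ac del: of_real_power)
    also have "\<dots> = (LINT \<xi>|lborel. LINT x|lborel. (cis (\<xi> \<bullet> x) * g x) * (cnj (?G \<xi>) * gauss (\<xi> /\<^sub>R m n)))"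
      by (subst fourier_transform_def) simp
    also have "\<dots> = (LINT x|lborel. LINT \<xi>|lborel. (cis (\<xi> \<bullet> x) * g x) * (cnj (?G \<xi>) * gauss (\<xi> /\<^sub>R m n)))"
      by (rule lborel_pair.integral_swap_dominated[OF _ integrable_mult_right[OF integrable_gauss_scaled[OF m[of n]], of B] integrable_norm[OF int]])
        (auto simp: norm_mult gauss_pos less_imp_le mult.commute[of "cmod (g _)"] intro!: mult_right_mono B)
    also have "\<dots> = (LINT x|lborel. g x * (LINT \<xi>|lborel. cis (\<xi> \<bullet> x) * cnj (?G \<xi>) * gauss (\<xi> /\<^sub>R m n)))"
      by (simp add: mult_ac flip: integral_mult_right_zero)
    also have "\<dots> = (LINT x|lborel. g x * (?c * K n x))"
      unfolding K_def by (simp only: gaussian_mollification[OF int m])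
    finally show ?thesis .
  qed
  have "(\<lambda>n. LINT x|lborel. g x * (?c * K n x)) \<longlonglongrightarrow> (LINT x|lborel. g x * (?c * (cnj (g x) * ?c)))"
  proof (rule integral_dominated_convergence[where w="\<lambda>x. cmod (g x) * (?c * (C * ?c))"])
    show "AE x in lborel. (\<lambda>n. g x * (?c * K n x)) \<longlonglongrightarrow> g x * (?c * (cnj (g x) * ?c))"
      by (intro AE_I2 tendsto_intros Klim)
    show "AE x in lborel. cmod (g x * (?c * K n x)) \<le> cmod (g x) * (?c * (C * ?c))" for n
      by (auto simp: norm_mult norm_power intro!: AE_I2 mult_left_mono Kbnd)
  qed (use int in auto)
  also have "(LINT x|lborel. g x * (?c * (cnj (g x) * ?c))) = (LINT x|lborel. complex_of_real (?c * ?c * (cmod (g x))\<^sup>2))"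
    by (intro Bochner_Integration.integral_cong refl) (simp add: complex_norm_square mult_ac del: of_real_power)
  also have "\<dots> = complex_of_real ((2 * pi) ^ DIM('a) * (LINT x|lborel. (cmod (g x))\<^sup>2))"
    by (simp only: integral_complex_of_real c integral_mult_right_zero)
  finally have lim: "I \<longlonglongrightarrow> (2 * pi) ^ DIM('a) * (LINT x|lborel. (cmod (g x))\<^sup>2)"
    unfolding Ieq[symmetric] by (simp only: tendsto_of_real_iff)
  \<comment> \<open>Integrability of the squared transform is still to be shown. Monotone
    convergence yields it from convergence of the integrals \<open>I n\<close>, together with the
    value.\<close>
  have mono: "AE \<xi> in lborel. mono (\<lambda>n. (cmod (?G \<xi>))\<^sup>2 * gauss (\<xi> /\<^sub>R m n))"
    by (auto simp: mono_def gauss_def m_def divide_simps intro!: AE_I2 mult_left_mono power_mono mult_right_mono)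
  have ptw: "AE \<xi> in lborel. (\<lambda>n. (cmod (?G \<xi>))\<^sup>2 * gauss (\<xi> /\<^sub>R m n)) \<longlonglongrightarrow> (cmod (?G \<xi>))\<^sup>2"
  proof (rule AE_I2)
    fix \<xi> :: 'a
    have "(\<lambda>n. exp (- (norm (\<xi> /\<^sub>R m n))\<^sup>2 / 2)) \<longlonglongrightarrow> exp (- (norm (0 *\<^sub>R \<xi>))\<^sup>2 / 2)"
      unfolding m_def by (intro tendsto_intros LIMSEQ_inverse_real_of_nat) auto
    then have "(\<lambda>n. (cmod (?G \<xi>))\<^sup>2 * exp (- (norm (\<xi> /\<^sub>R m n))\<^sup>2 / 2)) \<longlonglongrightarrow> (cmod (?G \<xi>))\<^sup>2 * 1"
      by (intro tendsto_mult tendsto_const) simp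
    then show "(\<lambda>n. (cmod (?G \<xi>))\<^sup>2 * gauss (\<xi> /\<^sub>R m n)) \<longlonglongrightarrow> (cmod (?G \<xi>))\<^sup>2"
      unfolding gauss_def by simp
  qed
  show "integrable lborel (\<lambda>\<xi>. (cmod (?G \<xi>))\<^sup>2)"
    by (rule integrable_monotone_convergence[OF intE mono ptw lim[unfolded I_def[abs_def]]]) measurable
  show "(LINT \<xi>|lborel. (cmod (?G \<xi>))\<^sup>2) = (2 * pi) ^ DIM('a) * (LINT x|lborel. (cmod (g x))\<^sup>2)"
    by (rule integral_monotone_convergence[OF intE mono ptw lim[unfolded I_def[abs_def]]]) measurable
qed

section \<open>Fourier analysis of the transition operators\<close>

lemma schwartz_continuous:
  assumes "\<phi> \<in> schwartz_space"
  shows "continuous_on UNIV \<phi>"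
proof -
  have "\<forall>bs. set bs \<subseteq> Basis \<longrightarrow> (\<forall>x. iterated_partial bs \<phi> differentiable (at x))"
    using assms unfolding schwartz_space_def by blast
  \<comment> \<open>The empty list of directions stands for the function itself.\<close>
  from this[rule_format, of "[]"] have "\<And>x. \<phi> differentiable (at x)"
    by simp
  then show ?thesis
    by (auto simp: continuous_on_eq_continuous_at intro: differentiable_imp_continuous_within)
qed

lemma schwartz_decay:
  assumes "\<phi> \<in> schwartz_space"
  obtains C where "\<And>x. (1 + norm x) ^ k * cmod (\<phi> x) \<le> C"
proof -
  have "\<forall>bs. set bs \<subseteq> Basis \<longrightarrow> (\<forall>k::nat. \<exists>C. \<forall>x. (1 + norm x) ^ k * cmod (iterated_partial bs \<phi> x) \<le> C)"
    using assms unfolding schwartz_space_def by blast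
  from this[rule_format, of "[]" k] show ?thesis using that by auto
qed

lemma schwartz_bounded:
  assumes "\<phi> \<in> schwartz_space"
  obtains C where "\<And>x. cmod (\<phi> x) \<le> C"
  using schwartz_decay[OF assms, of 0] by (metis mult_1 power_0)

text \<open>Each coordinate satisfies
  \<open>1 + (x \<bullet> b)\<^sup>2 \<le> (1 + norm x)\<^sup>2\<close>. Multiplying over the basis
  explains the exponent \<open>2 * DIM('a)\<close> and leaves a product of integrable
  one-dimensional weights.\<close>

lemma integrable_inverse_one_plus_norm:
  "integrable lborel (\<lambda>x::'a::euclidean_space. inverse ((1 + norm x) ^ (2 * DIM('a))))"
proof (rule Bochner_Integration.integrable_bound)
  have "integrable lborel (\<lambda>x::real. inverse (1 + x\<^sup>2))"
    using integrable_inverse_1_plus_square by (simp add: set_integrable_def)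
  then show "integrable lborel (\<lambda>x::'a. \<Prod>b\<in>Basis. inverse (1 + (x \<bullet> b)\<^sup>2))"
    by (intro integrable_lborel_prod)
  show "AE x::'a in lborel. norm (inverse ((1 + norm x) ^ (2 * DIM('a)))) \<le> norm (\<Prod>b\<in>Basis. inverse (1 + (x \<bullet> b)\<^sup>2))"
  proof (rule AE_I2)
    fix x :: 'a
    have "(\<Prod>b\<in>(Basis::'a set). inverse ((1 + norm x)\<^sup>2)) \<le> (\<Prod>b\<in>Basis. inverse (1 + (x \<bullet> b)\<^sup>2))"
    proof (rule prod_mono)
      fix b :: 'a assume b: "b \<in> Basis"
      have "(x \<bullet> b)\<^sup>2 \<le> (norm x)\<^sup>2" using Basis_le_norm[OF b] by (metis abs_ge_zero power2_abs power_mono)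
      then have "1 + (x \<bullet> b)\<^sup>2 \<le> (1 + norm x)\<^sup>2" by (simp add: power2_sum) (smt (verit) norm_ge_zero)
      then show "0 \<le> inverse ((1 + norm x)\<^sup>2) \<and> inverse ((1 + norm x)\<^sup>2) \<le> inverse (1 + (x \<bullet> b)\<^sup>2)"
        by (auto intro!: le_imp_inverse_le add_pos_nonneg)
    qed
    then show "norm (inverse ((1 + norm x) ^ (2 * DIM('a)))) \<le> norm (\<Prod>b\<in>Basis. inverse (1 + (x \<bullet> b)\<^sup>2))"
      by (simp add: power_mult power_inverse prod_nonneg)
  qed
qed simp

lemma schwartz_integrable:
  fixes \<phi> :: "'a::euclidean_space \<Rightarrow> complex"
  assumes "\<phi> \<in> schwartz_space"
  shows "integrable lborel \<phi>"
proof -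
  obtain C where C: "\<And>x. (1 + norm x) ^ (2 * DIM('a)) * cmod (\<phi> x) \<le> C"
    using schwartz_decay[OF assms] by blast
  show ?thesis
  proof (rule Bochner_Integration.integrable_bound)
    show "integrable lborel (\<lambda>x::'a. C * inverse ((1 + norm x) ^ (2 * DIM('a))))"
      using integrable_inverse_one_plus_norm by (rule integrable_mult_right)
    show "\<phi> \<in> borel_measurable lborel"
      using borel_measurable_continuous_onI[OF schwartz_continuous[OF assms]] by simp
    have "cmod (\<phi> x) \<le> C * inverse ((1 + norm x) ^ (2 * DIM('a)))" for x
    proof -
      have "0 < (1 + norm x) ^ (2 * DIM('a))" by (intro zero_less_power add_pos_nonneg) auto
      then show ?thesis using C[of x] by (simp add: field_simps)
    qed
    then show "AE x in lborel. cmod (\<phi> x) \<le> norm (C * inverse ((1 + norm x) ^ (2 * DIM('a))))"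
      unfolding real_norm_def by (intro AE_I2) (rule order_trans[OF _ abs_ge_self])
  qed
qed

section \<open>Convolution with the law of a random variable\<close>

context prob_space
begin

text \<open>By translation invariance the inner L1 norm is the same for every
  \<open>\<omega>\<close>, and constants are integrable over a probability space.\<close>

lemma integrable_pair_translate:
  fixes f :: "'b::euclidean_space \<Rightarrow> 'c::{banach, second_countable_topology}"
  assumes int: "integrable lborel f" and [measurable]: "Z \<in> borel_measurable M"
  shows "integrable (M \<Otimes>\<^sub>M lborel) (\<lambda>(\<omega>, x). f (x - Z \<omega>))"
proof -
  interpret P: pair_sigma_finite M "lborel :: 'b measure" ..
  have [measurable]: "f \<in> borel_measurable borel" using borel_measurable_integrable[OF int] by simp
  have tr: "integrable lborel (\<lambda>x. f (x - Z \<omega>))" for \<omega>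
    using integrable_lborel_affine[OF int, of 1 "- Z \<omega>"] by simp
  have "(LINT x|lborel. norm (f (x - Z \<omega>))) = (LINT x|lborel. norm (f x))" for \<omega>
    using integral_lborel_affine[of "\<lambda>x. norm (f x)" 1 "- Z \<omega>"] by simp
  then have "(\<lambda>\<omega>. LINT x|lborel. norm (case (\<omega>, x) of (\<omega>, x) \<Rightarrow> f (x - Z \<omega>))) = (\<lambda>\<omega>. LINT x|lborel. norm (f x))"
    by simp
  then show ?thesis
    by (intro P.Fubini_integrable) (simp_all only: prod.case tr integrable_const eventually_True, measurable)
qed

lemma integrable_convolve:
  fixes f :: "'b::euclidean_space \<Rightarrow> 'c::{banach, second_countable_topology}"
  assumes int: "integrable lborel f" and Z: "Z \<in> borel_measurable M"
  shows "integrable lborel (\<lambda>x. LINT \<omega>|M. f (x - Z \<omega>))"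
proof -
  interpret P: pair_sigma_finite M "lborel :: 'b measure" ..
  show ?thesis
    using P.integrable_snd[OF integrable_pair_translate[OF assms]] by simp
qed

text \<open>Shifting \<open>x\<close> by \<open>Z \<omega>\<close> inside the transform releases the
  phase \<open>cis (\<xi> \<bullet> Z \<omega>)\<close>, whose mean is the characteristic function
  of \<open>Z\<close>.\<close>

lemma fourier_transform_convolve:
  fixes f :: "'b::euclidean_space \<Rightarrow> complex"
  assumes int: "integrable lborel f" and [measurable]: "Z \<in> borel_measurable M"
  shows "fourier_transform (\<lambda>x. LINT \<omega>|M. f (x - Z \<omega>)) \<xi> = (LINT \<omega>|M. cis (\<xi> \<bullet> Z \<omega>)) * fourier_transform f \<xi>"
proof -
  interpret P: pair_sigma_finite M "lborel :: 'b measure" ..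
  have [measurable]: "f \<in> borel_measurable borel" using borel_measurable_integrable[OF int] by simp
  have i: "integrable (M \<Otimes>\<^sub>M lborel) (\<lambda>(\<omega>, x). cis (\<xi> \<bullet> x) * f (x - Z \<omega>))"
    using integrable_cis_mult[OF integrable_pair_translate[OF assms], of "\<lambda>(\<omega>, x). \<xi> \<bullet> x"]
    by (simp add: case_prod_beta')
  have "fourier_transform (\<lambda>x. LINT \<omega>|M. f (x - Z \<omega>)) \<xi> = (LINT x|lborel. LINT \<omega>|M. cis (\<xi> \<bullet> x) * f (x - Z \<omega>))"
    unfolding fourier_transform_def by simp
  also have "\<dots> = (LINT \<omega>|M. LINT x|lborel. cis (\<xi> \<bullet> x) * f (x - Z \<omega>))"
    using P.Fubini_integral[OF i] by simp
  also have "\<dots> = (LINT \<omega>|M. cis (\<xi> \<bullet> Z \<omega>) * fourier_transform f \<xi>)"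
  proof (intro Bochner_Integration.integral_cong refl)
    fix \<omega>
    have "(LINT x|lborel. cis (\<xi> \<bullet> x) * f (x - Z \<omega>)) =
        (LINT x|lborel. cis (\<xi> \<bullet> Z \<omega>) * (cis (\<xi> \<bullet> x) * f x))"
      by (subst integral_lborel_affine[of _ 1 "Z \<omega>"]) (auto simp: inner_add_right cis_mult[symmetric] mult_ac)
    then show "(LINT x|lborel. cis (\<xi> \<bullet> x) * f (x - Z \<omega>)) = cis (\<xi> \<bullet> Z \<omega>) * fourier_transform f \<xi>"
      by (simp add: fourier_transform_def)
  qed
  finally show ?thesis by simp
qed

text \<open>With \<open>integrable_convolve\<close> and \<open>continuous_convolve\<close>, this
  transfers the hypotheses of \<open>plancherel\<close> from a function to its average over random
  translates.\<close>

lemma norm_convolve_le: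
  fixes f :: "'b::euclidean_space \<Rightarrow> 'c::{banach, second_countable_topology}"
  assumes "continuous_on UNIV f" "\<And>x. norm (f x) \<le> C" and [measurable]: "Z \<in> borel_measurable M"
  shows "norm (LINT \<omega>|M. f (x - Z \<omega>)) \<le> C"
proof -
  have [measurable]: "f \<in> borel_measurable borel" using assms(1) by (rule borel_measurable_continuous_onI)
  have "norm (LINT \<omega>|M. f (x - Z \<omega>)) \<le> (LINT \<omega>|M. norm (f (x - Z \<omega>)))"
    by (rule integral_norm_bound)
  also have "\<dots> \<le> (LINT \<omega>|M. C)"
    using assms(2) order_trans[OF norm_ge_zero assms(2)] by (intro integral_mono integrable_const_bound[of _ C]) auto
  finally show ?thesis by (simp add: prob_space)
qed

lemma continuous_convolve:
  fixes f :: "'b::euclidean_space \<Rightarrow> 'c::{banach, second_countable_topology}"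
  assumes c: "continuous_on UNIV f" and b: "\<And>x. norm (f x) \<le> C" and [measurable]: "Z \<in> borel_measurable M"
  shows "continuous_on UNIV (\<lambda>x. LINT \<omega>|M. f (x - Z \<omega>))"
proof (rule continuous_on_sequentiallyI)
  have [measurable]: "f \<in> borel_measurable borel" using c by (rule borel_measurable_continuous_onI)
  fix u :: "nat \<Rightarrow> 'b" and a assume u: "u \<longlonglongrightarrow> a"
  show "(\<lambda>n. LINT \<omega>|M. f (u n - Z \<omega>)) \<longlonglongrightarrow> (LINT \<omega>|M. f (a - Z \<omega>))"
  proof (rule integral_dominated_convergence[where w="\<lambda>_. C"])
    show "AE \<omega> in M. (\<lambda>n. f (u n - Z \<omega>)) \<longlonglongrightarrow> f (a - Z \<omega>)"
      by (intro AE_I2 continuous_on_tendsto_compose[OF c] tendsto_intros u) auto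
  qed (use b in auto)
qed

end

text \<open>At time one the characteristic function has modulus
  \<open>exp (- Re (\<Psi> \<xi>))\<close>. A modulus of at most one gives the sign, and the
  logarithm recovers the real part measurably.\<close>

lemma characteristic_exponent_Re:
  fixes X :: "real \<Rightarrow> 'p \<Rightarrow> 'a::euclidean_space"
  assumes "levy_process M X" "characteristic_exponent M X \<Psi>"
  shows characteristic_exponent_Re_nonneg: "0 \<le> Re (\<Psi> \<xi>)"
    and borel_measurable_characteristic_exponent_Re: "(\<lambda>\<xi>. Re (\<Psi> \<xi>)) \<in> borel_measurable borel"
proof -
  interpret prob_space M using assms(1) by (simp add: levy_process_def)
  have [measurable]: "X 1 \<in> borel_measurable M" using assms(1) by (simp add: levy_process_def)
  have *: "cmod (LINT \<omega>|M. cis (\<xi> \<bullet> X 1 \<omega>)) = exp (- Re (\<Psi> \<xi>))" for \<xi>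
    using assms(2) by (simp add: characteristic_exponent_def)
  have "cmod (LINT \<omega>|M. cis (\<xi> \<bullet> X 1 \<omega>)) \<le> (LINT \<omega>|M. cmod (cis (\<xi> \<bullet> X 1 \<omega>)))" 
    by (rule integral_norm_bound)
  then show "0 \<le> Re (\<Psi> \<xi>)" unfolding * by (simp add: prob_space)
  have "(\<lambda>\<xi>. Re (\<Psi> \<xi>)) = (\<lambda>\<xi>. - ln (cmod (LINT \<omega>|M. cis (\<xi> \<bullet> X 1 \<omega>))))"
    unfolding * by simp
  also have "\<dots> \<in> borel_measurable borel" by measurable
  finally show "(\<lambda>\<xi>. Re (\<Psi> \<xi>)) \<in> borel_measurable borel" .
qed

text \<open>Plancherel at a fixed time: the operator multiplies the transform by
  \<open>exp (- s \<Psi>)\<close>, and the squared modulus of this multiplier involves only the real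
  part.\<close>

lemma nn_integral_dual_transition_op:
  fixes X :: "real \<Rightarrow> 'p \<Rightarrow> 'a::euclidean_space"
  assumes L: "levy_process M X" and E: "characteristic_exponent M X \<Psi>"
    and \<phi>: "\<phi> \<in> schwartz_space" and s: "s \<ge> 0"
  shows "(\<integral>\<^sup>+y. ennreal ((cmod (dual_transition_op M X s \<phi> y))\<^sup>2) \<partial>lborel) =
     ennreal (1 / (2 * pi) ^ DIM('a)) * (\<integral>\<^sup>+\<xi>. ennreal ((cmod (fourier_transform \<phi> \<xi>))\<^sup>2 * exp (- 2 * s * Re (\<Psi> \<xi>))) \<partial>lborel)"
proof -
  interpret prob_space M using L by (simp add: levy_process_def)
  have X: "X s \<in> borel_measurable M" using L s by (simp add: levy_process_def)
  obtain C where C: "\<And>x. cmod (\<phi> x) \<le> C" using schwartz_bounded[OF \<phi>] by blast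
  note c = schwartz_continuous[OF \<phi>] and i = schwartz_integrable[OF \<phi>]
  let ?g = "dual_transition_op M X s \<phi>"
  have g: "?g = (\<lambda>x. LINT \<omega>|M. \<phi> (x - X s \<omega>))" unfolding dual_transition_op_def ..
  have gc: "continuous_on UNIV ?g" unfolding g by (rule continuous_convolve[OF c C X])
  have gb: "cmod (?g x) \<le> C" for x unfolding g by (rule norm_convolve_le[OF c C X])
  have gi: "integrable lborel ?g" unfolding g by (rule integrable_convolve[OF i X])
  \<comment> \<open>A bounded integrable function is square integrable, since
    \<open>\<bar>g\<bar>\<^sup>2 \<le> C \<bar>g\<bar>\<close>.\<close>
  have gi2: "integrable lborel (\<lambda>x. (cmod (?g x))\<^sup>2)"
  proof (rule Bochner_Integration.integrable_bound)
    show "integrable lborel (\<lambda>x. C * cmod (?g x))" using gi by auto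
    show "AE x in lborel. norm ((cmod (?g x))\<^sup>2) \<le> norm (C * cmod (?g x))"
      using gb order_trans[OF gb abs_ge_self] by (auto simp: power2_eq_square abs_mult intro!: AE_I2 mult_right_mono)
    show "(\<lambda>x. (cmod (?g x))\<^sup>2) \<in> borel_measurable lborel" using gi by measurable
  qed
  have ft: "(cmod (fourier_transform ?g \<xi>))\<^sup>2 = (cmod (fourier_transform \<phi> \<xi>))\<^sup>2 * exp (- 2 * s * Re (\<Psi> \<xi>))" for \<xi>
  proof -
    have "fourier_transform ?g \<xi> = exp (- (of_real s * \<Psi> \<xi>)) * fourier_transform \<phi> \<xi>"
      using fourier_transform_convolve[OF i X] E s unfolding g by (simp add: characteristic_exponent_def)
    then show ?thesis
      by (simp add: norm_mult power_mult_distrib flip: exp_double)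
  qed
  have "(\<integral>\<^sup>+y. ennreal ((cmod (?g y))\<^sup>2) \<partial>lborel) = ennreal (LINT y|lborel. (cmod (?g y))\<^sup>2)"
    by (rule nn_integral_eq_integral[OF gi2]) simp
  also have "\<dots> = ennreal (1 / (2 * pi) ^ DIM('a) * (LINT \<xi>|lborel. (cmod (fourier_transform ?g \<xi>))\<^sup>2))"
    unfolding integral_fourier_transform_square[OF gc gb gi] by simp
  also have "\<dots> = ennreal (1 / (2 * pi) ^ DIM('a)) * (\<integral>\<^sup>+\<xi>. ennreal ((cmod (fourier_transform ?g \<xi>))\<^sup>2) \<partial>lborel)"
    by (subst nn_integral_eq_integral[OF integrable_fourier_transform_square[OF gc gb gi]]) (simp_all only: ennreal_mult' zero_le_power2 zero_le_divide_1_iff pi_ge_zero zero_le_power mult_nonneg_nonneg zero_le_numeral eventually_True)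
  finally show ?thesis unfolding ft .
qed

section \<open>The Wiener isometry\<close>

text \<open>A quadratic substitute for Minkowski's inequality: letting \<open>\<delta> \<rightarrow> 0\<close> transports L2 norms through
  L2 limits without any finiteness assumption.\<close>

lemma cmod_square_le_weighted:
  assumes "\<delta> > 0"
  shows "(cmod a)\<^sup>2 \<le> (1 + \<delta>) * (cmod b)\<^sup>2 + (1 + 1 / \<delta>) * (cmod (a - b))\<^sup>2"
proof -
  define u v where "u = cmod b" and "v = cmod (a - b)"
  have "cmod a \<le> u + v" using norm_triangle_ineq[of b "a - b"] by (simp add: u_def v_def)
  then have "(cmod a)\<^sup>2 \<le> (u + v)\<^sup>2" by (intro power_mono) auto
  \<comment> \<open>Expanding this square gives Young's inequality
    \<open>2 u v \<le> \<delta> u\<^sup>2 + v\<^sup>2 / \<delta>\<close>, which absorbs the cross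
    term.\<close>
  also have "0 \<le> (\<delta> * u - v)\<^sup>2 / \<delta>" using assms by simp
  then have "(u + v)\<^sup>2 \<le> (1 + \<delta>) * u\<^sup>2 + (1 + 1 / \<delta>) * v\<^sup>2"
    using assms by (simp add: power2_eq_square field_simps)
  finally show ?thesis by (simp add: u_def v_def)
qed

lemma nn_integral_square_le_weighted:
  assumes [measurable]: "f \<in> borel_measurable M" "g \<in> borel_measurable M" and \<delta>: "\<delta> > 0"
  shows "(\<integral>\<^sup>+x. ennreal ((cmod (f x))\<^sup>2) \<partial>M) \<le>
    ennreal (1 + \<delta>) * (\<integral>\<^sup>+x. ennreal ((cmod (g x))\<^sup>2) \<partial>M) +
    ennreal (1 + 1 / \<delta>) * (\<integral>\<^sup>+x. ennreal ((cmod (f x - g x))\<^sup>2) \<partial>M)"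
proof -
  have "(\<integral>\<^sup>+x. ennreal ((cmod (f x))\<^sup>2) \<partial>M) \<le>
     (\<integral>\<^sup>+x. (ennreal (1 + \<delta>) * ennreal ((cmod (g x))\<^sup>2) + ennreal (1 + 1 / \<delta>) * ennreal ((cmod (f x - g x))\<^sup>2)) \<partial>M)"
    using \<delta> cmod_square_le_weighted[OF \<delta>]
    by (intro nn_integral_mono) (simp add: ennreal_mult[symmetric] ennreal_plus[symmetric] add_nonneg_nonneg del: ennreal_plus)
  also have "\<dots> = ennreal (1 + \<delta>) * (\<integral>\<^sup>+x. ennreal ((cmod (g x))\<^sup>2) \<partial>M) +
    ennreal (1 + 1 / \<delta>) * (\<integral>\<^sup>+x. ennreal ((cmod (f x - g x))\<^sup>2) \<partial>M)"
    by (simp add: nn_integral_add nn_integral_cmult)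
  finally show ?thesis .
qed

text \<open>The weighted inequality compares \<open>g\<close> with \<open>gn n\<close>, and
  \<open>fn n\<close> with \<open>f\<close>. First \<open>n\<close> tends to infinity at fixed
  \<open>\<delta>\<close>, then \<open>\<delta>\<close> to 0. Exchanging the roles of the two spaces
  gives the reverse inequality.\<close>

lemma nn_integral_square_limit_le:
  fixes f :: "_ \<Rightarrow> complex"
  assumes [measurable]: "f \<in> borel_measurable M" "\<And>n::nat. fn n \<in> borel_measurable M"
    "g \<in> borel_measurable N" "\<And>n. gn n \<in> borel_measurable N"
    and eq: "\<And>n. (\<integral>\<^sup>+x. ennreal ((cmod (fn n x))\<^sup>2) \<partial>M) = (\<integral>\<^sup>+x. ennreal ((cmod (gn n x))\<^sup>2) \<partial>N)"
    and f: "(\<lambda>n. \<integral>\<^sup>+x. ennreal ((cmod (f x - fn n x))\<^sup>2) \<partial>M) \<longlonglongrightarrow> 0"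
    and g: "(\<lambda>n. \<integral>\<^sup>+x. ennreal ((cmod (g x - gn n x))\<^sup>2) \<partial>N) \<longlonglongrightarrow> 0"
  shows "(\<integral>\<^sup>+x. ennreal ((cmod (g x))\<^sup>2) \<partial>N) \<le> (\<integral>\<^sup>+x. ennreal ((cmod (f x))\<^sup>2) \<partial>M)"
proof -
  let ?a = "\<integral>\<^sup>+x. ennreal ((cmod (f x))\<^sup>2) \<partial>M" and ?b = "\<integral>\<^sup>+x. ennreal ((cmod (g x))\<^sup>2) \<partial>N"
  let ?e = "\<lambda>n. \<integral>\<^sup>+x. ennreal ((cmod (f x - fn n x))\<^sup>2) \<partial>M"
    and ?e' = "\<lambda>n. \<integral>\<^sup>+x. ennreal ((cmod (g x - gn n x))\<^sup>2) \<partial>N"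
  have bound: "?b \<le> ennreal (1 + \<delta>) * (ennreal (1 + \<delta>) * ?a)" if \<delta>: "\<delta> > 0" for \<delta>
  proof -
    let ?p = "ennreal (1 + \<delta>)" and ?q = "ennreal (1 + 1 / \<delta>)"
    have "?b \<le> ?p * (?p * ?a + ?q * ?e n) + ?q * ?e' n" for n
    proof -
      have "?b \<le> ?p * (\<integral>\<^sup>+x. ennreal ((cmod (gn n x))\<^sup>2) \<partial>N) + ?q * ?e' n"
        by (intro nn_integral_square_le_weighted \<delta>) measurable
      also have "(\<integral>\<^sup>+x. ennreal ((cmod (gn n x))\<^sup>2) \<partial>N) \<le> ?p * ?a + ?q * ?e n"
        using nn_integral_square_le_weighted[of "fn n" M f \<delta>] \<delta> by (simp add: eq norm_minus_commute)
      finally show ?thesis by (simp add: mult_left_mono add_right_mono)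
    qed
    moreover have "(\<lambda>n. ?p * (?p * ?a + ?q * ?e n) + ?q * ?e' n) \<longlonglongrightarrow> ?p * (?p * ?a + ?q * 0) + ?q * 0"
      by (intro tendsto_intros ennreal_tendsto_cmult f g) auto
    ultimately show ?thesis
      by (metis (no_types, lifting) LIMSEQ_le_const add.right_neutral mult_zero_right)
  qed
  show ?thesis
  proof (cases "?a = \<infinity>")
    case False
    then obtain a where a: "?a = ennreal a" "a \<ge> 0" by (cases ?a) auto
    \<comment> \<open>The choice \<open>\<delta> = 1 / (n + 1)\<close>.\<close>
    have lim: "(\<lambda>n. ennreal ((1 + inverse (real (Suc n))) * ((1 + inverse (real (Suc n))) * a))) \<longlonglongrightarrow> ennreal ((1 + 0) * ((1 + 0) * a))"
      by (intro tendsto_intros LIMSEQ_inverse_real_of_nat)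
    have "?b \<le> ennreal ((1 + inverse (real (Suc n))) * ((1 + inverse (real (Suc n))) * a))" for n
      using bound[of "inverse (real (Suc n))"] a by (simp add: ennreal_mult)
    then show ?thesis
      using LIMSEQ_le_const[OF lim] a by auto
  qed auto
qed

text \<open>The covariances in \<open>white_noise\<close> are Bochner integrals, and an equation
  between values does not give integrability; it comes from the Gaussian law.\<close>

lemma centered_gaussian_square_integrable:
  assumes "centered_gaussian N Y"
  shows "integrable N (\<lambda>\<omega>. (Y \<omega>)\<^sup>2)"
proof -
  have [measurable]: "Y \<in> borel_measurable N" using assms by (simp add: centered_gaussian_def)
  consider "AE \<omega> in N. Y \<omega> = 0" | \<sigma> where "\<sigma> > 0" "distributed N lborel Y (normal_density 0 \<sigma>)"
    using assms by (auto simp: centered_gaussian_def)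
  then show ?thesis
  proof cases
    case 1
    then have "AE \<omega> in N. (Y \<omega>)\<^sup>2 = 0" by auto
    then show ?thesis by (subst integrable_cong_AE[where g="\<lambda>_. 0"]) auto
  next
    case 2
    show ?thesis
      using integrable_normal_moment[OF 2(1), of 0 2] 
      by (subst distributed_integrable[OF 2(2), symmetric]) auto
  qed
qed

text \<open>The joint Gaussian condition for a singleton family with coefficient 1.\<close>

lemma white_noise_centered_gaussian:
  assumes W: "white_noise N w" and A: "A \<in> noise_sets"
  shows "centered_gaussian N (w A)"
proof -
  have "finite {A} \<and> {A} \<subseteq> noise_sets \<longrightarrow> centered_gaussian N (\<lambda>\<omega>. \<Sum>A\<in>{A}. (1::real) * w A \<omega>)"
    using W unfolding white_noise_def by (elim conjE allE[of _ "{A}"] allE[of _ "\<lambda>_. 1"]) assumption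
  then show ?thesis using A by simp
qed

text \<open>The L2 norm of a combination depends on the \<open>u j\<close> only through their Gram
  matrix, so families on different measure spaces can be compared. \<open>Re\<close> merely converts
  the complex double sum to its real value.\<close>

lemma nn_integral_square_sum:
  fixes u :: "'i \<Rightarrow> 'x \<Rightarrow> real" and c :: "'i \<Rightarrow> complex"
  assumes i: "\<And>j k. j \<in> I \<Longrightarrow> k \<in> I \<Longrightarrow> integrable Q (\<lambda>x. u j x * u k x)"
  shows "(\<integral>\<^sup>+x. ennreal ((cmod (\<Sum>j\<in>I. c j * of_real (u j x)))\<^sup>2) \<partial>Q) =
    ennreal (Re (\<Sum>j\<in>I. \<Sum>k\<in>I. c j * cnj (c k) * of_real (LINT x|Q. u j x * u k x)))"
proof -
  have sq: "complex_of_real ((cmod (\<Sum>j\<in>I. c j * of_real (u j x)))\<^sup>2) =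
      (\<Sum>j\<in>I. \<Sum>k\<in>I. c j * cnj (c k) * of_real (u j x * u k x))" for x
    by (simp add: complex_norm_square sum_product mult_ac del: of_real_power)
  have ic: "integrable Q (\<lambda>x. c j * cnj (c k) * complex_of_real (u j x * u k x))" if "j \<in> I" "k \<in> I" for j k
    using i[OF that] by (intro integrable_mult_right integrable_of_real)
  have icc: "integrable Q (\<lambda>x. complex_of_real ((cmod (\<Sum>j\<in>I. c j * of_real (u j x)))\<^sup>2))"
    unfolding sq by (intro Bochner_Integration.integrable_sum ic)
  have int: "integrable Q (\<lambda>x. (cmod (\<Sum>j\<in>I. c j * of_real (u j x)))\<^sup>2)"
    using integrable_Re[OF icc] by (simp only: Re_complex_of_real)
  have "complex_of_real (LINT x|Q. (cmod (\<Sum>j\<in>I. c j * of_real (u j x)))\<^sup>2) =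
      (LINT x|Q. complex_of_real ((cmod (\<Sum>j\<in>I. c j * of_real (u j x)))\<^sup>2))"
    by (rule integral_complex_of_real[symmetric])
  also have "\<dots> = (\<Sum>j\<in>I. (LINT x|Q. (\<Sum>k\<in>I. c j * cnj (c k) * of_real (u j x * u k x))))"
    unfolding sq by (intro Bochner_Integration.integral_sum Bochner_Integration.integrable_sum ic)
  also have "\<dots> = (\<Sum>j\<in>I. \<Sum>k\<in>I. (LINT x|Q. c j * cnj (c k) * of_real (u j x * u k x)))"
    by (intro sum.cong refl Bochner_Integration.integral_sum ic)
  also have "\<dots> = (\<Sum>j\<in>I. \<Sum>k\<in>I. c j * cnj (c k) * of_real (LINT x|Q. u j x * u k x))"
    by (simp only: integral_mult_right_zero integral_complex_of_real)
  finally have "(LINT x|Q. (cmod (\<Sum>j\<in>I. c j * of_real (u j x)))\<^sup>2) =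
      Re (\<Sum>j\<in>I. \<Sum>k\<in>I. c j * cnj (c k) * of_real (LINT x|Q. u j x * u k x))"
    by (metis Re_complex_of_real)
  then show ?thesis
    by (subst nn_integral_eq_integral[OF int]) simp_all
qed

text \<open>The noise values \<open>w A\<close> and the indicators of \<open>A\<close> have the same
  Gram matrix, with entries \<open>measure lborel (A \<inter> B)\<close>.\<close>

lemma white_noise_isometry_simple:
  fixes w :: "(real \<times> 'a::euclidean_space) set \<Rightarrow> 'q \<Rightarrow> real"
  assumes W: "white_noise N w" and sub: "\<A> \<subseteq> noise_sets"
  shows "(\<integral>\<^sup>+\<omega>. ennreal ((cmod (\<Sum>A\<in>\<A>. c A * of_real (w A \<omega>)))\<^sup>2) \<partial>N) =
    (\<integral>\<^sup>+z. ennreal ((cmod (\<Sum>A\<in>\<A>. c A * indicator A z))\<^sup>2) \<partial>lborel)"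
proof -
  have g: "centered_gaussian N (w A)" if "A \<in> \<A>" for A
    using white_noise_centered_gaussian[OF W] that sub by blast
  have [measurable]: "w A \<in> borel_measurable N" if "A \<in> \<A>" for A
    using g[OF that] by (simp add: centered_gaussian_def)
  have iw: "integrable N (\<lambda>\<omega>. w A \<omega> * w B \<omega>)" if "A \<in> \<A>" "B \<in> \<A>" for A B
  proof (rule Bochner_Integration.integrable_bound)
    show "integrable N (\<lambda>\<omega>. (w A \<omega>)\<^sup>2 + (w B \<omega>)\<^sup>2)"
      using that by (intro Bochner_Integration.integrable_add centered_gaussian_square_integrable g)
    show "(\<lambda>\<omega>. w A \<omega> * w B \<omega>) \<in> borel_measurable N" using that by measurable
    have "norm (x * y) \<le> norm (x\<^sup>2 + y\<^sup>2)" for x y :: real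
    proof -
      have "0 \<le> \<bar>x\<bar> * \<bar>y\<bar>" by simp
      moreover have "2 * (\<bar>x\<bar> * \<bar>y\<bar>) \<le> x\<^sup>2 + y\<^sup>2"
        using sum_squares_bound[of "\<bar>x\<bar>" "\<bar>y\<bar>"] by (simp add: mult.assoc)
      ultimately show ?thesis unfolding real_norm_def abs_mult by linarith
    qed
    then show "AE \<omega> in N. norm (w A \<omega> * w B \<omega>) \<le> norm ((w A \<omega>)\<^sup>2 + (w B \<omega>)\<^sup>2)" by (intro AE_I2)
  qed
  have ii: "integrable lborel (\<lambda>z. indicator A z * indicator B z :: real)"
    "(LINT z|lborel. indicator A z * indicator B z :: real) = measure lborel (A \<inter> B)" if "A \<in> \<A>" "B \<in> \<A>" for A B
  proof -
    have AB: "A \<in> sets lborel" "B \<in> sets lborel" "emeasure lborel A < \<infinity>"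
      using that sub by (auto simp: noise_sets_def)
    then have "emeasure lborel (A \<inter> B) < \<infinity>"
      by (meson emeasure_mono inf_le1 order_le_less_trans)
    moreover have "(\<lambda>z. indicator A z * indicator B z :: real) = indicator (A \<inter> B)"
      by (simp add: fun_eq_iff indicator_inter_arith)
    ultimately show "integrable lborel (\<lambda>z. indicator A z * indicator B z :: real)"
       "(LINT z|lborel. indicator A z * indicator B z :: real) = measure lborel (A \<inter> B)"
      using AB by (auto intro!: integrable_real_indicator)
  qed
  have cov: "(LINT \<omega>|N. w A \<omega> * w B \<omega>) = measure lborel (A \<inter> B)" if "A \<in> \<A>" "B \<in> \<A>" for A B
    using W that sub unfolding white_noise_def by blast
  have "(\<Sum>A\<in>\<A>. c A * indicator A z) = (\<Sum>A\<in>\<A>. c A * of_real (indicator A z))" for z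
    by (simp add: of_real_indicator)
  then show ?thesis
    using nn_integral_square_sum[OF iw, where c=c] nn_integral_square_sum[OF ii(1), where c=c] cov ii(2)
    by (simp cong: sum.cong)
qed

text \<open>The approximating sums have equal L2 norms on both spaces, and
  \<open>nn_integral_square_limit_le\<close>, used in both directions, carries the equality to the
  limits.\<close>

lemma wiener_isometry:
  fixes w :: "(real \<times> 'a::euclidean_space) set \<Rightarrow> 'q \<Rightarrow> real"
  assumes W: "white_noise N w" and I: "has_wiener_integral N w f Y"
  shows "(\<integral>\<^sup>+\<omega>. ennreal ((cmod (Y \<omega>))\<^sup>2) \<partial>N) = (\<integral>\<^sup>+z\<in>{0..} \<times> UNIV. ennreal ((cmod (f z))\<^sup>2) \<partial>lborel)"
proof -
  let ?H = "{0..} \<times> UNIV :: (real \<times> 'a) set"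
  have H[measurable]: "?H \<in> sets borel" by (intro borel_closed closed_Times) auto
  have [measurable]: "f \<in> borel_measurable borel" "Y \<in> borel_measurable N"
    using I by (auto simp: has_wiener_integral_def)
  obtain \<A> c where \<A>: "\<And>n::nat. finite (\<A> n)" "\<And>n. \<A> n \<subseteq> noise_sets"
    and f: "(\<lambda>n. \<integral>\<^sup>+z\<in>?H. ennreal ((cmod (f z - (\<Sum>A\<in>\<A> n. c n A * indicator A z)))\<^sup>2) \<partial>lborel) \<longlonglongrightarrow> 0"
    and Y: "(\<lambda>n. \<integral>\<^sup>+\<omega>. ennreal ((cmod (Y \<omega> - (\<Sum>A\<in>\<A> n. c n A * of_real (w A \<omega>))))\<^sup>2) \<partial>N) \<longlonglongrightarrow> 0"
    using I unfolding has_wiener_integral_def by blast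
  define fn where "fn n z = (\<Sum>A\<in>\<A> n. c n A * indicator A z)" for n z
  define Yn where "Yn n \<omega> = (\<Sum>A\<in>\<A> n. c n A * complex_of_real (w A \<omega>))" for n \<omega>
  \<comment> \<open>Cutting \<open>f\<close> off outside the half-space, where the simple functions
    vanish anyway, turns the restricted integrals into integrals over the whole space.\<close>
  define f0 where "f0 z = indicator ?H z * f z" for z
  have fnm[measurable]: "fn n \<in> borel_measurable lborel" for n
    unfolding fn_def using \<A>(2)[of n] by (auto simp: noise_sets_def intro!: borel_measurable_sum borel_measurable_times borel_measurable_indicator)
  have f0m[measurable]: "f0 \<in> borel_measurable lborel" unfolding f0_def by measurable
  have Ynm[measurable]: "Yn n \<in> borel_measurable N" for n
  proof -
    have "w A \<in> borel_measurable N" if "A \<in> \<A> n" for A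
      using white_noise_centered_gaussian[OF W, of A] that \<A>(2)[of n] by (auto simp: centered_gaussian_def)
    then show ?thesis unfolding Yn_def by (intro borel_measurable_sum borel_measurable_times) auto
  qed
  have eq: "(\<integral>\<^sup>+z. ennreal ((cmod (fn n z))\<^sup>2) \<partial>lborel) = (\<integral>\<^sup>+\<omega>. ennreal ((cmod (Yn n \<omega>))\<^sup>2) \<partial>N)" for n
    unfolding fn_def Yn_def using white_noise_isometry_simple[OF W \<A>(2)] by simp
  have supp: "fn n z = 0" if "z \<notin> ?H" for n z
    unfolding fn_def using \<A>(2)[of n] that by (intro sum.neutral ballI) (force simp: noise_sets_def indicator_def)
  have "ennreal ((cmod (f z - fn n z))\<^sup>2) * indicator ?H z = ennreal ((cmod (f0 z - fn n z))\<^sup>2)" for n z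
    using supp[of z n] by (auto simp: f0_def indicator_def)
  then have f': "(\<lambda>n. \<integral>\<^sup>+z. ennreal ((cmod (f0 z - fn n z))\<^sup>2) \<partial>lborel) \<longlonglongrightarrow> 0"
    using f unfolding fn_def[symmetric] by simp
  have Y': "(\<lambda>n. \<integral>\<^sup>+\<omega>. ennreal ((cmod (Y \<omega> - Yn n \<omega>))\<^sup>2) \<partial>N) \<longlonglongrightarrow> 0"
    using Y unfolding Yn_def .
  have "(\<integral>\<^sup>+\<omega>. ennreal ((cmod (Y \<omega>))\<^sup>2) \<partial>N) = (\<integral>\<^sup>+z. ennreal ((cmod (f0 z))\<^sup>2) \<partial>lborel)"
    by (intro antisym nn_integral_square_limit_le[OF _ _ _ _ eq f' Y']
        nn_integral_square_limit_le[OF _ _ _ _ eq[symmetric] Y' f']) measurable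
  also have "\<dots> = (\<integral>\<^sup>+z\<in>?H. ennreal ((cmod (f z))\<^sup>2) \<partial>lborel)"
    by (intro nn_integral_cong) (auto simp: f0_def indicator_def)
  finally show ?thesis .
qed

section \<open>Second moment of the weak solution\<close>

text \<open>As \<open>r\<close> may be 0, the integral is compared with the one at the positive rate
  \<open>q = 1 / \<kappa> + r\<close>. The two integrands differ by the factor
  \<open>exp (- 2 (t - s) / \<kappa>)\<close>, which lies between
  \<open>exp (- 2 t / \<kappa>)\<close> and 1.\<close>

lemma exp_decay_integral_bounds:
  fixes r \<kappa> t :: real
  assumes r: "r \<ge> 0" and \<kappa>: "\<kappa> > 0" and t: "t \<ge> 0"
  shows "ennreal ((1 - exp (- 2 * t / \<kappa>)) / 2 / (1 / \<kappa> + r)) \<le>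
      (\<integral>\<^sup>+s. ennreal (exp (- 2 * (t - s) * r)) * indicator {0..t} s \<partial>lborel)"
    and "(\<integral>\<^sup>+s. ennreal (exp (- 2 * (t - s) * r)) * indicator {0..t} s \<partial>lborel) \<le>
      ennreal (exp (2 * t / \<kappa>) / 2 / (1 / \<kappa> + r))"
proof -
  define q where "q = 1 / \<kappa> + r"
  have q: "q > 0" "1 / \<kappa> \<le> q" using r \<kappa> by (auto simp: q_def add_pos_nonneg)
  let ?I = "\<integral>\<^sup>+s. ennreal (exp (- 2 * (t - s) * r)) * indicator {0..t} s \<partial>lborel"
  let ?J = "\<integral>\<^sup>+s. ennreal (exp (- 2 * (t - s) * q)) * indicator {0..t} s \<partial>lborel"
  \<comment> \<open>The antiderivative in \<open>s\<close> is
    \<open>exp (- 2 (t - s) q) / (2 q)\<close>.\<close>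
  have "?J = ennreal (exp (- 2 * (t - t) * q) / (2 * q) - exp (- 2 * (t - 0) * q) / (2 * q))"
    using q t by (intro nn_integral_FTC_Icc) (auto intro!: derivative_eq_intros)
  then have J: "?J = ennreal ((1 - exp (- 2 * t * q)) / (2 * q))"
    by (simp add: diff_divide_distrib)
  \<comment> \<open>Replacing \<open>q\<close> by the smaller \<open>1 / \<kappa>\<close> makes the
    numerator independent of \<open>r\<close>, so that it becomes a constant in the frequency
    integral.\<close>
  have "- 2 * t * q \<le> - 2 * t * (1 / \<kappa>)"
    using mult_left_mono[OF q(2), of "2 * t"] t by simp
  then have "exp (- 2 * t * q) \<le> exp (- 2 * t / \<kappa>)" by simp
  then have "(1 - exp (- 2 * t / \<kappa>)) / 2 / q \<le> (1 - exp (- 2 * t * q)) / (2 * q)"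
    using q by (simp add: divide_right_mono)
  then have "ennreal ((1 - exp (- 2 * t / \<kappa>)) / 2 / q) \<le> ?J"
    unfolding J by (rule ennreal_leI)
  also have "?J \<le> ?I"
    using \<kappa> by (intro nn_integral_mono) (auto simp: q_def intro!: mult_left_mono_neg split: split_indicator)
  finally show "ennreal ((1 - exp (- 2 * t / \<kappa>)) / 2 / (1 / \<kappa> + r)) \<le> ?I" unfolding q_def .
  have le: "exp (- 2 * (t - s) * r) \<le> exp (2 * t / \<kappa>) * exp (- 2 * (t - s) * q)" if "s \<in> {0..t}" for s
  proof -
    have "2 * t / \<kappa> + (- 2 * (t - s) * q) = - 2 * (t - s) * r + 2 * s / \<kappa>"
      unfolding q_def using \<kappa> by (simp add: field_simps)
    moreover have "0 \<le> 2 * s / \<kappa>" using that \<kappa> by simp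
    ultimately have "- 2 * (t - s) * r \<le> 2 * t / \<kappa> + (- 2 * (t - s) * q)" by linarith
    then show ?thesis unfolding exp_add[symmetric] by (rule iffD2[OF exp_le_cancel_iff])
  qed
  have "?I \<le> (\<integral>\<^sup>+s. ennreal (exp (2 * t / \<kappa>)) * (ennreal (exp (- 2 * (t - s) * q)) * indicator {0..t} s) \<partial>lborel)"
    using le by (intro nn_integral_mono) (auto simp: ennreal_mult[symmetric] split: split_indicator)
  also have "\<dots> = ennreal (exp (2 * t / \<kappa>)) * ?J" by (intro nn_integral_cmult) measurable
  also have "\<dots> = ennreal (exp (2 * t / \<kappa>) * ((1 - exp (- 2 * t * q)) / (2 * q)))"
    unfolding J using q t by (intro ennreal_mult[symmetric]) auto
  also have "\<dots> \<le> ennreal (exp (2 * t / \<kappa>) * (1 / (2 * q)))"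
    using q by (intro ennreal_leI mult_left_mono divide_right_mono) auto
  also have "\<dots> = ennreal (exp (2 * t / \<kappa>) / 2 / (1 / \<kappa> + r))" by (simp add: q_def)
  finally show "?I \<le> ennreal (exp (2 * t / \<kappa>) / 2 / (1 / \<kappa> + r))" .
qed

text \<open>The denominator is at least \<open>1 / \<kappa>\<close> and the squared transform is
  integrable by Plancherel, so the Bochner integral in the energy is a genuine finite value rather
  than the default 0.\<close>

lemma nn_integral_levy_energy:
  fixes \<Psi> :: "'a::euclidean_space \<Rightarrow> complex"
  assumes \<phi>: "\<phi> \<in> schwartz_space" and \<kappa>: "\<kappa> > 0"
    and \<Psi>: "\<And>\<xi>. 0 \<le> Re (\<Psi> \<xi>)" "(\<lambda>\<xi>. Re (\<Psi> \<xi>)) \<in> borel_measurable borel"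
  shows "ennreal (levy_energy \<Psi> \<kappa> \<phi>) = ennreal (1 / (2 * pi) ^ DIM('a)) *
    (\<integral>\<^sup>+\<xi>. ennreal ((cmod (fourier_transform \<phi> \<xi>))\<^sup>2 / (1 / \<kappa> + Re (\<Psi> \<xi>))) \<partial>lborel)"
    and "0 \<le> levy_energy \<Psi> \<kappa> \<phi>"
proof -
  note \<Psi>(2)[measurable]
  note i = schwartz_integrable[OF \<phi>]
  have [measurable]: "fourier_transform \<phi> \<in> borel_measurable borel"
    using i by (intro borel_measurable_fourier_transform) auto
  obtain C where C: "\<And>x. cmod (\<phi> x) \<le> C" using schwartz_bounded[OF \<phi>] by blast
  have pos: "0 < 1 / \<kappa> + Re (\<Psi> \<xi>)" for \<xi> using \<kappa> \<Psi>(1)[of \<xi>] by (intro add_pos_nonneg) auto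
  let ?e = "\<lambda>\<xi>. (cmod (fourier_transform \<phi> \<xi>))\<^sup>2 / (1 / \<kappa> + Re (\<Psi> \<xi>))"
  have nn: "0 \<le> ?e \<xi>" for \<xi> using pos[of \<xi>] by (intro divide_nonneg_pos) auto
  have int: "integrable lborel ?e"
  proof (rule Bochner_Integration.integrable_bound)
    show "integrable lborel (\<lambda>\<xi>. (cmod (fourier_transform \<phi> \<xi>))\<^sup>2 / (1 / \<kappa>))"
      by (intro integrable_divide integrable_fourier_transform_square[OF schwartz_continuous[OF \<phi>] C i])
    have "?e \<xi> \<le> (cmod (fourier_transform \<phi> \<xi>))\<^sup>2 / (1 / \<kappa>)" for \<xi>
      using \<kappa> pos[of \<xi>] \<Psi>(1)[of \<xi>] by (intro divide_left_mono) auto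
    then show "AE \<xi> in lborel. norm (?e \<xi>) \<le> norm ((cmod (fourier_transform \<phi> \<xi>))\<^sup>2 / (1 / \<kappa>))"
      unfolding real_norm_def abs_of_nonneg[OF nn] by (intro AE_I2) (rule order_trans[OF _ abs_ge_self])
  qed measurable
  have I0: "0 \<le> integral\<^sup>L lborel ?e" using nn by simp
  show "0 \<le> levy_energy \<Psi> \<kappa> \<phi>" unfolding levy_energy_def using I0 by (intro mult_nonneg_nonneg) auto
  show "ennreal (levy_energy \<Psi> \<kappa> \<phi>) = ennreal (1 / (2 * pi) ^ DIM('a)) * (\<integral>\<^sup>+\<xi>. ennreal (?e \<xi>) \<partial>lborel)"
    unfolding levy_energy_def
    by (subst nn_integral_eq_integral[OF int AE_I2[OF nn]]) (intro ennreal_mult I0, simp)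
qed

text \<open>Stated with nonnegative integrals, so that both uses of Tonelli require only
  measurability; finiteness follows later from the upper bound.\<close>

lemma weak_heat_solution_second_moment:
  fixes X :: "real \<Rightarrow> 'p \<Rightarrow> 'a::euclidean_space"
  assumes L: "levy_process M X" and E: "characteristic_exponent M X \<Psi>"
    and W: "white_noise N w" and H: "weak_heat_solution M X N w H"
    and \<phi>: "\<phi> \<in> schwartz_space" and t: "t \<ge> 0"
  shows "(\<integral>\<^sup>+\<omega>. ennreal ((cmod (H t \<phi> \<omega>))\<^sup>2) \<partial>N) = ennreal (1 / (2 * pi) ^ DIM('a)) *
    (\<integral>\<^sup>+\<xi>. ennreal ((cmod (fourier_transform \<phi> \<xi>))\<^sup>2) *
      (\<integral>\<^sup>+s. ennreal (exp (- 2 * (t - s) * Re (\<Psi> \<xi>))) * indicator {0..t} s \<partial>lborel) \<partial>lborel)"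
proof -
  note borel_measurable_characteristic_exponent_Re[OF L E, measurable]
  have [measurable]: "fourier_transform \<phi> \<in> borel_measurable borel"
    using schwartz_integrable[OF \<phi>] by (intro borel_measurable_fourier_transform) auto
  let ?f = "\<lambda>(s, y). indicator {0..t} s * dual_transition_op M X (t - s) \<phi> y"
  let ?c = "ennreal (1 / (2 * pi) ^ DIM('a))"
  have wi: "has_wiener_integral N w ?f (H t \<phi>)"
    using H t \<phi> unfolding weak_heat_solution_def by blast
  \<comment> \<open>Joint measurability in time and space is contained in
    \<open>has_wiener_integral\<close>.\<close>
  then have [measurable]: "?f \<in> borel_measurable borel" by (simp add: has_wiener_integral_def)
  then have fm: "?f \<in> borel_measurable (lborel \<Otimes>\<^sub>M lborel)" by (simp add: lborel_prod)
  have "(\<integral>\<^sup>+\<omega>. ennreal ((cmod (H t \<phi> \<omega>))\<^sup>2) \<partial>N) = (\<integral>\<^sup>+z. ennreal ((cmod (?f z))\<^sup>2) * indicator ({0..} \<times> UNIV) z \<partial>lborel)"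
    by (rule wiener_isometry[OF W wi])
  also have "\<dots> = (\<integral>\<^sup>+z. ennreal ((cmod (?f z))\<^sup>2) \<partial>(lborel \<Otimes>\<^sub>M lborel))"
    unfolding lborel_prod by (intro nn_integral_cong) (auto simp: indicator_def)
  also have "\<dots> = (\<integral>\<^sup>+s. \<integral>\<^sup>+y. ennreal ((cmod (?f (s, y)))\<^sup>2) \<partial>lborel \<partial>lborel)"
    by (intro lborel.nn_integral_fst[symmetric] measurable_compose[OF fm]) measurable
  also have "\<dots> = (\<integral>\<^sup>+s. ?c * (\<integral>\<^sup>+\<xi>. ennreal ((cmod (fourier_transform \<phi> \<xi>))\<^sup>2) *
      (ennreal (exp (- 2 * (t - s) * Re (\<Psi> \<xi>))) * indicator {0..t} s) \<partial>lborel) \<partial>lborel)"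
  proof (intro nn_integral_cong)
    fix s :: real
    show "(\<integral>\<^sup>+y. ennreal ((cmod (?f (s, y)))\<^sup>2) \<partial>lborel) = ?c * (\<integral>\<^sup>+\<xi>. ennreal ((cmod (fourier_transform \<phi> \<xi>))\<^sup>2) *
      (ennreal (exp (- 2 * (t - s) * Re (\<Psi> \<xi>))) * indicator {0..t} s) \<partial>lborel)"
    \<comment> \<open>For \<open>s\<close> in the interval, Plancherel applies at time
      \<open>t - s\<close>; otherwise both sides are 0.\<close>
    proof (cases "s \<in> {0..t}")
      case True
      then have "t - s \<ge> 0" by simp
      from nn_integral_dual_transition_op[OF L E \<phi> this] True show ?thesis
        by (simp add: ennreal_mult)
    qed simp
  qed
  also have "\<dots> = ?c * (\<integral>\<^sup>+s. \<integral>\<^sup>+\<xi>. ennreal ((cmod (fourier_transform \<phi> \<xi>))\<^sup>2) *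
      (ennreal (exp (- 2 * (t - s) * Re (\<Psi> \<xi>))) * indicator {0..t} s) \<partial>lborel \<partial>lborel)"
    by (intro nn_integral_cmult) measurable
  also have "\<dots> = ?c * (\<integral>\<^sup>+\<xi>. \<integral>\<^sup>+s. ennreal ((cmod (fourier_transform \<phi> \<xi>))\<^sup>2) *
      (ennreal (exp (- 2 * (t - s) * Re (\<Psi> \<xi>))) * indicator {0..t} s) \<partial>lborel \<partial>lborel)"
    by (intro arg_cong[where f="(*) ?c"] lborel_pair.Fubini') measurable
  also have "\<dots> = ?c * (\<integral>\<^sup>+\<xi>. ennreal ((cmod (fourier_transform \<phi> \<xi>))\<^sup>2) *
      (\<integral>\<^sup>+s. ennreal (exp (- 2 * (t - s) * Re (\<Psi> \<xi>))) * indicator {0..t} s \<partial>lborel) \<partial>lborel)"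
    by (intro arg_cong[where f="(*) ?c"] nn_integral_cong nn_integral_cmult) measurable
  finally show ?thesis .
qed

theorem proposition3p1:
  fixes M :: "'p measure" and X :: "real \<Rightarrow> 'p \<Rightarrow> 'a::euclidean_space"
    and \<Psi> :: "'a \<Rightarrow> complex" and L :: "(('a \<Rightarrow> complex) \<times> ('a \<Rightarrow> complex)) set"
    and N :: "'q measure" and w :: "(real \<times> 'a) set \<Rightarrow> 'q \<Rightarrow> real"
    and H :: "real \<Rightarrow> ('a \<Rightarrow> complex) \<Rightarrow> 'q \<Rightarrow> complex"
  assumes "levy_process M X"
    and "characteristic_exponent M X \<Psi>"
    and "L = L2_generator M X"
    and "white_noise N w"
    and "weak_heat_solution M X N w H"
  shows "\<forall>\<phi>\<in>schwartz_space. \<forall>\<kappa>>0. \<forall>t\<ge>0.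
     (1 - exp (- 2 * t / \<kappa>)) / 2 * levy_energy \<Psi> \<kappa> \<phi> \<le> (LINT \<omega>|N. (cmod (H t \<phi> \<omega>))\<^sup>2) \<and>
     (LINT \<omega>|N. (cmod (H t \<phi> \<omega>))\<^sup>2) \<le> exp (2 * t / \<kappa>) / 2 * levy_energy \<Psi> \<kappa> \<phi>"
proof (intro ballI allI impI)
  fix \<phi> :: "'a \<Rightarrow> complex" and \<kappa> t :: real
  assume \<phi>: "\<phi> \<in> schwartz_space" and \<kappa>: "0 < \<kappa>" and t: "0 \<le> t"
  note \<Psi> = characteristic_exponent_Re[OF assms(1,2)]
  note \<Psi>(2)[measurable]
  have [measurable]: "fourier_transform \<phi> \<in> borel_measurable borel"
    using schwartz_integrable[OF \<phi>] by (intro borel_measurable_fourier_transform) auto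
  have pos: "0 < 1 / \<kappa> + Re (\<Psi> \<xi>)" for \<xi> using \<kappa> \<Psi>(1)[of \<xi>] by (intro add_pos_nonneg) auto
  have Hm: "H t \<phi> \<in> borel_measurable N"
    using assms(5) \<phi> t by (auto simp: weak_heat_solution_def has_wiener_integral_def)
  let ?S = "\<integral>\<^sup>+\<omega>. ennreal ((cmod (H t \<phi> \<omega>))\<^sup>2) \<partial>N"
  let ?c = "ennreal (1 / (2 * pi) ^ DIM('a))"
  let ?I = "\<lambda>\<xi>. \<integral>\<^sup>+s. ennreal (exp (- 2 * (t - s) * Re (\<Psi> \<xi>))) * indicator {0..t} s \<partial>lborel"
  note S = weak_heat_solution_second_moment[OF assms(1,2,4,5) \<phi> t]
  note en = nn_integral_levy_energy[OF \<phi> \<kappa> \<Psi>]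
  note bounds = exp_decay_integral_bounds[OF \<Psi>(1) \<kappa> t]
  \<comment> \<open>Gives both bounds the shape of the second moment formula, so that the bounds on
    the time integral can be inserted pointwise in \<open>\<xi>\<close>.\<close>
  have scaled: "ennreal (K * levy_energy \<Psi> \<kappa> \<phi>) =
      ?c * (\<integral>\<^sup>+\<xi>. ennreal ((cmod (fourier_transform \<phi> \<xi>))\<^sup>2) * ennreal (K / (1 / \<kappa> + Re (\<Psi> \<xi>))) \<partial>lborel)" if K: "K \<ge> 0" for K
  proof -
    have "ennreal (K * levy_energy \<Psi> \<kappa> \<phi>) = ?c * (ennreal K *
        (\<integral>\<^sup>+\<xi>. ennreal ((cmod (fourier_transform \<phi> \<xi>))\<^sup>2 / (1 / \<kappa> + Re (\<Psi> \<xi>))) \<partial>lborel))"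
      using K en by (simp only: ennreal_mult mult_ac)
    also have "\<dots> = ?c * (\<integral>\<^sup>+\<xi>. ennreal K *
        ennreal ((cmod (fourier_transform \<phi> \<xi>))\<^sup>2 / (1 / \<kappa> + Re (\<Psi> \<xi>))) \<partial>lborel)"
      by (intro arg_cong[where f="(*) ?c"] nn_integral_cmult[symmetric]) measurable
    also have "\<dots> = ?c * (\<integral>\<^sup>+\<xi>. ennreal ((cmod (fourier_transform \<phi> \<xi>))\<^sup>2) * ennreal (K / (1 / \<kappa> + Re (\<Psi> \<xi>))) \<partial>lborel)"
      using K pos by (intro arg_cong[where f="(*) ?c"] nn_integral_cong) (simp add: ennreal_mult[symmetric] less_imp_le)
    finally show ?thesis .
  qed
  have exp_le: "exp (- 2 * t / \<kappa>) \<le> 1" using t \<kappa> by simp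
  have lower: "ennreal ((1 - exp (- 2 * t / \<kappa>)) / 2 * levy_energy \<Psi> \<kappa> \<phi>) \<le> ?S"
    unfolding S using exp_le by (subst scaled) (simp, intro mult_left_mono nn_integral_mono bounds(1) zero_le)
  have upper: "?S \<le> ennreal (exp (2 * t / \<kappa>) / 2 * levy_energy \<Psi> \<kappa> \<phi>)"
    unfolding S by (subst scaled) (simp, intro mult_left_mono nn_integral_mono bounds(2) zero_le)
  have eq: "(LINT \<omega>|N. (cmod (H t \<phi> \<omega>))\<^sup>2) = enn2real ?S"
    using Hm by (intro integral_eq_nn_integral) auto
  \<comment> \<open>\<open>enn2real\<close> would send an infinite second moment to 0;
    \<open>upper\<close> excludes this case.\<close>
  have S_eq: "?S = ennreal (LINT \<omega>|N. (cmod (H t \<phi> \<omega>))\<^sup>2)"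
    unfolding eq using upper by (simp add: le_less_trans)
  show "(1 - exp (- 2 * t / \<kappa>)) / 2 * levy_energy \<Psi> \<kappa> \<phi> \<le> (LINT \<omega>|N. (cmod (H t \<phi> \<omega>))\<^sup>2) \<and>
     (LINT \<omega>|N. (cmod (H t \<phi> \<omega>))\<^sup>2) \<le> exp (2 * t / \<kappa>) / 2 * levy_energy \<Psi> \<kappa> \<phi>"
  proof
    show "(1 - exp (- 2 * t / \<kappa>)) / 2 * levy_energy \<Psi> \<kappa> \<phi> \<le> (LINT \<omega>|N. (cmod (H t \<phi> \<omega>))\<^sup>2)"
      using lower unfolding S_eq by (rule iffD1[OF ennreal_le_iff, rotated]) simp
    \<comment> \<open>Returning from \<open>ennreal\<close> to reals requires the larger side to be
      nonnegative, which here is nonnegativity of the energy.\<close>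
    show "(LINT \<omega>|N. (cmod (H t \<phi> \<omega>))\<^sup>2) \<le> exp (2 * t / \<kappa>) / 2 * levy_energy \<Psi> \<kappa> \<phi>"
      using upper unfolding S_eq by (rule iffD1[OF ennreal_le_iff, rotated]) (simp add: en(2))
  qed
qed

end
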